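(* Let $\Bbbk$ be a field, let $\Delta$ be a finite simplicial complex on $[m]=\{1,\dots,m\}$ without ghost vertices, let $n_1,\dots,n_m\ge 2$ be integers, and put $A=\Bbbk[x_1,\dots,x_m]/\bigl(I_\Delta+(x_1^{n_1},\dots,x_m^{n_m})\bigr)$, with graded maximal ideal $\mathfrak m_A=(x_1,\dots,x_m)A$. Let $q\ge 1$ be an integer and suppose that $\Delta$ is flag. Then $\operatorname{tr}_A(\omega_A)=\mathfrak m_A^q$ if and only if both of the following hold: (i) a face $F\in\Delta$ is free exactly when $|F|\ge q$; (ii) if $q\ge 2$, then $n_1=\cdots=n_m=2$.
   Context: A simplicial complex $\Delta$ on $[m]$ is a set of subsets (faces) of $[m]$ closed under taking subsets and containing $\varnothing$. A vertex $i$ is a ghost vertex if $\{i\}\notin\Delta$. Facets are maximal faces. A face (possibly empty) is free if it is contained in a unique facet. For $F\subseteq[m]$ put $x_F=\prod_{i\in F}x_i$; $I_\Delta=(x_F: F\subseteq[m],\ F\notin\Delta)$ is the Stanley--Reisner ideal. The $1$-skeleton $\Delta^{(1)}$ is the graph on the non-ghost vertices whose edges are the two-element faces; $\Delta$ is flag if every clique of $\Delta^{(1)}$ is a face of $\Delta$. For an Artinian positively graded $\Bbbk$-algebra $A$ (with $A_0=\Bbbk$), the canonical module is $\omega_A=\operatorname{Hom}_{\Bbbk}(A,\Bbbk)$ with $(a\lambda)(b)=\lambda(ab)$, and the canonical trace is the ideal $\operatorname{tr}_A(\omega_A)=\sum_{\varphi\in\operatorname{Hom}_A(\omega_A,A)}\varphi(\omega_A)$.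 *)

theory Defs
  imports
    "HOL-Library.Poly_Mapping"
    "HOL-Algebra.Module"
    "HOL-Algebra.QuotRing"
    "HOL-Algebra.Ideal_Product"
begin

section \<open>Simplicial complexes on \<open>{1..m}\<close>\<close>

definition simplicial_complex_on :: "nat \<Rightarrow> nat set set \<Rightarrow> bool" where
  "simplicial_complex_on m \<Delta> \<longleftrightarrow>
     \<Delta> \<subseteq> Pow {1..m} \<and> {} \<in> \<Delta> \<and> (\<forall>F\<in>\<Delta>. \<forall>G. G \<subseteq> F \<longrightarrow> G \<in> \<Delta>)"

definition ghost_vertex :: "nat set set \<Rightarrow> nat \<Rightarrow> bool" where
  "ghost_vertex \<Delta> i \<longleftrightarrow> {i} \<notin> \<Delta>"

definition facet :: "nat set set \<Rightarrow> nat set \<Rightarrow> bool" where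
  "facet \<Delta> F \<longleftrightarrow> F \<in> \<Delta> \<and> (\<forall>G\<in>\<Delta>. F \<subseteq> G \<longrightarrow> G = F)"

definition free_face :: "nat set set \<Rightarrow> nat set \<Rightarrow> bool" where
  "free_face \<Delta> F \<longleftrightarrow> F \<in> \<Delta> \<and> (\<exists>!G. facet \<Delta> G \<and> F \<subseteq> G)"

definition skeleton_verts :: "nat set set \<Rightarrow> nat set" where
  "skeleton_verts \<Delta> = {i. \<not> ghost_vertex \<Delta> i}"

definition skeleton_edges :: "nat set set \<Rightarrow> nat set set" where
  "skeleton_edges \<Delta> = {e \<in> \<Delta>. card e = 2}"

definition skeleton_clique :: "nat set set \<Rightarrow> nat set \<Rightarrow> bool" where
  "skeleton_clique \<Delta> W \<longleftrightarrow>
     W \<subseteq> skeleton_verts \<Delta> \<and> (\<forall>i\<in>W. \<forall>j\<in>W. i \<noteq> j \<longrightarrow> {i, j} \<in> skeleton_edges \<Delta>)"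

definition flag :: "nat set set \<Rightarrow> bool" where
  "flag \<Delta> \<longleftrightarrow> (\<forall>W. skeleton_clique \<Delta> W \<longrightarrow> W \<in> \<Delta>)"


section \<open>The polynomial ring and the algebra \<open>A\<close>\<close>

text \<open>
  A polynomial is a finitely supported map from exponent vectors to coefficients;
  multiplication is the convolution product of \<^theory>\<open>HOL-Library.Poly_Mapping\<close>.
  The variables are indexed by all natural numbers, and the polynomial ring in the
  variables \<open>x\<^sub>1, \<dots>, x\<^sub>m\<close> is cut out by its carrier.
\<close>

type_synonym 'k mpoly = "(nat \<Rightarrow>\<^sub>0 nat) \<Rightarrow>\<^sub>0 'k"

definition poly_ring :: "nat \<Rightarrow> ('k::field) mpoly ring" where
  "poly_ring m =
     \<lparr>carrier = {p. \<forall>t \<in> Poly_Mapping.keys p. Poly_Mapping.keys t \<subseteq> {1..m}},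
      mult = (*), one = 1, zero = 0, add = (+)\<rparr>"

definition const :: "'k::field \<Rightarrow> 'k mpoly" where
  "const c = Poly_Mapping.single 0 c"

definition var :: "nat \<Rightarrow> ('k::field) mpoly" where
  "var i = Poly_Mapping.single (Poly_Mapping.single i 1) 1"

definition stanley_reisner_ideal :: "nat \<Rightarrow> nat set set \<Rightarrow> ('k::field) mpoly set" where
  "stanley_reisner_ideal m \<Delta> =
     Idl\<^bsub>poly_ring m\<^esub> {\<Prod>i\<in>F. var i | F. F \<subseteq> {1..m} \<and> F \<notin> \<Delta>}"

definition defining_ideal :: "nat \<Rightarrow> nat set set \<Rightarrow> (nat \<Rightarrow> nat) \<Rightarrow> ('k::field) mpoly set" where
  "defining_ideal m \<Delta> n =
     stanley_reisner_ideal m \<Delta> <+>\<^bsub>poly_ring m\<^esub> Idl\<^bsub>poly_ring m\<^esub> {var i ^ n i | i. i \<in> {1..m}}"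

definition artinian_algebra ::
    "nat \<Rightarrow> nat set set \<Rightarrow> (nat \<Rightarrow> nat) \<Rightarrow> ('k::field) mpoly set ring" where
  "artinian_algebra m \<Delta> n = poly_ring m Quot defining_ideal m \<Delta> n"

definition residue_class ::
    "nat \<Rightarrow> nat set set \<Rightarrow> (nat \<Rightarrow> nat) \<Rightarrow> ('k::field) mpoly \<Rightarrow> 'k mpoly set" where
  "residue_class m \<Delta> n p = defining_ideal m \<Delta> n +>\<^bsub>poly_ring m\<^esub> p"

definition graded_maximal_ideal ::
    "nat \<Rightarrow> nat set set \<Rightarrow> (nat \<Rightarrow> nat) \<Rightarrow> ('k::field) mpoly set set" where
  "graded_maximal_ideal m \<Delta> n =
     Idl\<^bsub>artinian_algebra m \<Delta> n\<^esub> ((\<lambda>i. residue_class m \<Delta> n (var i)) ` {1..m})"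


section \<open>Canonical module and canonical trace\<close>

text \<open>
  A \<open>k\<close>-algebra is given by a ring \<open>A\<close> together with its structure map \<open>\<kappa>\<close> from \<open>k\<close> to \<open>A\<close>;
  scalar multiplication by \<open>c\<close> is multiplication by \<open>\<kappa> c\<close>. The functionals are extensional
  (\<^term>\<open>undefined\<close> outside the carrier of \<open>A\<close>), so that they are determined by their
  values on \<open>A\<close>. The \<open>mult\<close> and \<open>one\<close> components of a \<^typ>\<open>('a, 'b) module\<close> play no role
  in its module structure.
\<close>

definition canonical_module ::
    "('k::field \<Rightarrow> 'a) \<Rightarrow> 'a ring \<Rightarrow> ('a, 'a \<Rightarrow> 'k) module" where
  "canonical_module \<kappa> A =
     \<lparr>carrier = {l \<in> extensional (carrier A).
        (\<forall>a\<in>carrier A. \<forall>b\<in>carrier A. l (a \<oplus>\<^bsub>A\<^esub> b) = l a + l b) \<and>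
        (\<forall>c. \<forall>a\<in>carrier A. l (\<kappa> c \<otimes>\<^bsub>A\<^esub> a) = c * l a)},
      mult = undefined, one = undefined,
      zero = (\<lambda>b\<in>carrier A. 0),
      add = (\<lambda>l l'. \<lambda>b\<in>carrier A. l b + l' b),
      smult = (\<lambda>a l. \<lambda>b\<in>carrier A. l (a \<otimes>\<^bsub>A\<^esub> b))\<rparr>"

definition module_Hom ::
    "'a ring \<Rightarrow> ('a, 'b) module \<Rightarrow> ('a, 'c) module \<Rightarrow> ('b \<Rightarrow> 'c) set" where
  "module_Hom A M N =
     {\<phi> \<in> carrier M \<rightarrow>\<^sub>E carrier N.
        (\<forall>x\<in>carrier M. \<forall>y\<in>carrier M. \<phi> (x \<oplus>\<^bsub>M\<^esub> y) = \<phi> x \<oplus>\<^bsub>N\<^esub> \<phi> y) \<and>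
        (\<forall>a\<in>carrier A. \<forall>x\<in>carrier M. \<phi> (a \<odot>\<^bsub>M\<^esub> x) = a \<odot>\<^bsub>N\<^esub> \<phi> x)}"

definition regular_module :: "'a ring \<Rightarrow> ('a, 'a) module" where
  "regular_module A =
     \<lparr>carrier = carrier A, mult = mult A, one = one A, zero = zero A, add = add A,
      smult = mult A\<rparr>"

text \<open>The sum of a family of ideals is the ideal generated by their union.\<close>

definition trace_ideal :: "'a ring \<Rightarrow> ('a, 'b) module \<Rightarrow> 'a set" where
  "trace_ideal A M = Idl\<^bsub>A\<^esub> (\<Union>\<phi>\<in>module_Hom A M (regular_module A). \<phi> ` carrier M)"

end

theory Submission
  imports Defs
begin

text \<open>
  The algebra \<open>A\<close> has a basis of monomials \<open>x\<^sup>u\<close>, and for flag \<open>\<Delta>\<close> the trace of the canonical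
  module is spanned by those \<open>x\<^sup>u\<close> whose support is a free face. Indeed, if the support \<open>F\<close> of
  \<open>u\<close> is not free, there are vertices \<open>i\<close>, \<open>j\<close> of the link of \<open>F\<close> that are not adjacent. Since
  \<open>x\<^sub>i x\<^sub>j = 0\<close> in \<open>A\<close>, every functional is a sum of one killed by \<open>x\<^sub>i\<close> and one killed by \<open>x\<^sub>j\<close>;
  as \<open>x\<^sub>i x\<^sup>u\<close> and \<open>x\<^sub>j x\<^sup>u\<close> are nonzero, no homomorphism to \<open>A\<close> has an image involving \<open>x\<^sup>u\<close>.
  Conversely, if \<open>F\<close> lies in a unique facet \<open>G\<close>, the monomials of \<open>A\<close> divisible by \<open>x\<^sub>F\<close> form
  a box of exponents whose upper corner is the socle monomial of \<open>G\<close>, and reflecting functionals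
  in this box is a homomorphism with \<open>x\<^sub>F\<close> in its image. As the \<open>q\<close>-th power of the maximal ideal
  is spanned by the \<open>x\<^sup>u\<close> of degree at least \<open>q\<close>, the claim becomes a comparison of two sets of
  exponents.
\<close>

section \<open>Polynomials as coefficient functions\<close>

abbreviation "lookup \<equiv> Poly_Mapping.lookup"
abbreviation "keys \<equiv> Poly_Mapping.keys"
abbreviation "single \<equiv> Poly_Mapping.single"

text \<open>A finitely supported map is the finite sum of its terms. The \<open>single\<close> case
  concerns only terms that occur in \<open>p\<close>, so facts about the support of \<open>p\<close>
  remain available there.\<close>

lemma poly_mapping_induct_keys [case_names zero single add]:
  fixes p :: "'a \<Rightarrow>\<^sub>0 'b::comm_monoid_add"
  assumes "Q 0"
    and "\<And>t. t \<in> keys p \<Longrightarrow> Q (single t (lookup p t))"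
    and "\<And>p q. Q p \<Longrightarrow> Q q \<Longrightarrow> Q (p + q)"
  shows "Q p"
proof -
  have "Q (\<Sum>t\<in>T. single t (lookup p t))" if "T \<subseteq> keys p" for T
    using finite_subset[OF that finite_keys] that
    by (induction T rule: finite_induct) (auto intro: assms)
  moreover have "p = (\<Sum>t\<in>keys p. single t (lookup p t))"
    by (rule poly_mapping_eqI)
      (auto simp: lookup_sum lookup_single when_def sum.delta in_keys_iff)
  ultimately show ?thesis by (metis order_refl)
qed

lemma keys_add_nat: "keys (s + t) = keys s \<union> keys t"
  for s t :: "'a \<Rightarrow>\<^sub>0 nat"
  by (auto simp: in_keys_iff lookup_add)

text \<open>By cancellation of exponents, \<open>s\<close> is the only exponent of \<open>p\<close>
  that is moved to \<open>t + s\<close>, so a single term contributes.\<close>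

lemma lookup_single_times_add:
  fixes p :: "'a::cancel_comm_monoid_add \<Rightarrow>\<^sub>0 'b::semiring_0"
  shows "lookup (single t c * p) (t + s) = c * lookup p s"
  by (induction p rule: poly_mapping_induct_keys)
    (auto simp: distrib_left lookup_add mult_single lookup_single when_def)

lemma keys_single_times:
  "keys (single t c * p) \<subseteq> (+) t ` keys p"
  using keys_mult[of "single t c" p] by (auto split: if_splits)

lemma prod_var_eq_single:
  "finite F \<Longrightarrow> (\<Prod>i\<in>F. var i :: 'k::field mpoly)
    = single (\<Sum>i\<in>F. single i 1) 1"
  by (induction F rule: finite_induct) (auto simp: var_def mult_single)

lemma var_power_eq_single:
  "(var i :: 'k::field mpoly) ^ k = single (single i k) 1"
  by (induction k) (auto simp: var_def mult_single single_add[symmetric])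

text \<open>This linear projection serves to drop the nonstandard terms of a representative and, by
  precomposition, to split a functional into two.\<close>

definition restrict_keys :: "'a set \<Rightarrow> ('a \<Rightarrow>\<^sub>0 'b::zero) \<Rightarrow> 'a \<Rightarrow>\<^sub>0 'b" where
  "restrict_keys S = Poly_Mapping.mapp (\<lambda>t c. c when t \<in> S)"

lemma lookup_restrict_keys: "lookup (restrict_keys S p) t = (lookup p t when t \<in> S)"
  by (simp add: restrict_keys_def lookup_mapp when_def in_keys_iff)

section \<open>The polynomial ring in \<open>m\<close> variables\<close>

lemma carrier_poly_ring:
  "p \<in> carrier (poly_ring m) \<longleftrightarrow> (\<forall>t. lookup p t \<noteq> 0 \<longrightarrow> keys t \<subseteq> {1..m})"
  by (auto simp: poly_ring_def in_keys_iff)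

lemma poly_ring_simps [simp]:
  "mult (poly_ring m) = (*)" "one (poly_ring m) = 1"
  "zero (poly_ring m) = 0" "add (poly_ring m) = (+)"
  by (simp_all add: poly_ring_def)

lemma single_in_carrier:
  "keys t \<subseteq> {1..m} \<Longrightarrow> single t c \<in> carrier (poly_ring m)"
  by (auto simp: carrier_poly_ring lookup_single when_def)

lemma add_in_carrier:
  "p \<in> carrier (poly_ring m) \<Longrightarrow> q \<in> carrier (poly_ring m) \<Longrightarrow> p + q \<in> carrier (poly_ring m)"
  by (metis (no_types, lifting) add.right_neutral carrier_poly_ring lookup_add)

lemma uminus_in_carrier:
  "p \<in> carrier (poly_ring m) \<Longrightarrow> - p \<in> carrier (poly_ring m)"
  by (auto simp: carrier_poly_ring)

lemma times_in_carrier: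
  assumes "p \<in> carrier (poly_ring m)" "q \<in> carrier (poly_ring m)"
  shows "p * q \<in> carrier (poly_ring m)"
  unfolding carrier_poly_ring in_keys_iff[symmetric]
proof (intro allI impI)
  fix t assume "t \<in> keys (p * q)"
  then obtain a b where "t = a + b" "a \<in> keys p" "b \<in> keys q"
    using keys_mult[of p q] by blast
  with assms show "keys t \<subseteq> {1..m}"
    by (metis Un_subset_iff carrier_poly_ring in_keys_iff keys_add_nat)
qed

lemma restrict_keys_in_carrier:
  "p \<in> carrier (poly_ring m) \<Longrightarrow> restrict_keys S p \<in> carrier (poly_ring m)"
  by (auto simp: carrier_poly_ring lookup_restrict_keys when_def)

lemma zero_in_carrier: "0 \<in> carrier (poly_ring m)"
  by (simp add: carrier_poly_ring)

lemma one_in_carrier: "1 \<in> carrier (poly_ring m)"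
  by (simp add: carrier_poly_ring lookup_one when_def)

lemma poly_ring_cring: "cring (poly_ring m :: 'k::field mpoly ring)"
proof (rule cringI)
  show "abelian_group (poly_ring m :: 'k mpoly ring)"
  proof (rule abelian_groupI, unfold poly_ring_simps)
    show "\<exists>y\<in>carrier (poly_ring m). y + x = 0"
      if "x \<in> carrier (poly_ring m)" for x :: "'k mpoly"
      using uminus_in_carrier[OF that] by (intro bexI[of _ "- x"]) simp_all
  qed (simp_all add: add_in_carrier zero_in_carrier add_ac)
  show "Group.comm_monoid (poly_ring m :: 'k mpoly ring)"
    by (rule comm_monoidI, unfold poly_ring_simps)
      (simp_all add: times_in_carrier one_in_carrier mult_ac)
qed (simp add: distrib_right)

text \<open>The exponent of the squarefree monomial \<open>x_F\<close>.\<close>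

definition monomial_exp :: "nat set \<Rightarrow> nat \<Rightarrow>\<^sub>0 nat" where
  "monomial_exp F = (\<Sum>i\<in>F. single i 1)"

lemma lookup_monomial_exp:
  "finite F \<Longrightarrow> lookup (monomial_exp F) i = (1 when i \<in> F)"
  by (simp add: monomial_exp_def lookup_sum lookup_single when_def sum.delta)

lemma keys_monomial_exp: "finite F \<Longrightarrow> keys (monomial_exp F) = F"
  by (auto simp: in_keys_iff lookup_monomial_exp when_def split: if_splits)

lemma lookup_const_times: "lookup (const c * p) t = c * lookup p t"
  using lookup_single_times_add[of 0 c p t] by (simp add: const_def)

section \<open>Monomial bases and monomial ideals\<close>

locale artinian_stanley_reisner =
  fixes m :: nat and \<Delta> :: "nat set set" and n :: "nat \<Rightarrow> nat"
  assumes complex: "simplicial_complex_on m \<Delta>"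
    and no_ghost: "\<forall>i\<in>{1..m}. \<not> ghost_vertex \<Delta> i"
    and n_ge_2: "\<forall>i\<in>{1..m}. n i \<ge> 2"
begin

abbreviation "P \<equiv> poly_ring m"
abbreviation "J \<equiv> defining_ideal m \<Delta> n"
abbreviation "A \<equiv> artinian_algebra m \<Delta> n"
abbreviation "cls \<equiv> residue_class m \<Delta> n"

text \<open>The exponents of the monomial basis of \<open>A\<close>.\<close>

definition std :: "(nat \<Rightarrow>\<^sub>0 nat) set" where
  "std = {t. keys t \<in> \<Delta> \<and> (\<forall>i\<in>keys t. lookup t i < n i)}"

lemma face_subset: "F \<in> \<Delta> \<Longrightarrow> G \<subseteq> F \<Longrightarrow> G \<in> \<Delta>"
  and face_verts: "F \<in> \<Delta> \<Longrightarrow> F \<subseteq> {1..m}"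
  using complex by (auto simp: simplicial_complex_on_def)

lemma face_finite: "F \<in> \<Delta> \<Longrightarrow> finite F"
  using face_verts finite_subset by blast

lemma finite_complex: "finite \<Delta>"
  using complex finite_subset by (fastforce simp: simplicial_complex_on_def)

lemma std_keys: "t \<in> std \<Longrightarrow> keys t \<subseteq> {1..m}"
  using face_verts by (simp add: std_def)

lemma std_lessD: "t \<in> std \<Longrightarrow> i \<in> keys t \<Longrightarrow> lookup t i < n i"
  by (simp add: std_def)

text \<open>Divisors of a standard monomial are standard: subsets of faces are faces, and the bounds
  on the exponents pass to smaller exponents.\<close>

lemma std_addD:
  assumes "s + t \<in> std" shows "s \<in> std" "t \<in> std"
proof -
  have "keys s \<union> keys t \<in> \<Delta>"
    using assms by (simp add: std_def keys_add_nat)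
  then have "keys s \<in> \<Delta>" "keys t \<in> \<Delta>"
    by (auto intro: face_subset)
  moreover have "lookup s i + lookup t i < n i" if "i \<in> keys s \<union> keys t" for i
    using assms that by (simp add: std_def keys_add_nat lookup_add)
  ultimately show "s \<in> std" "t \<in> std"
    unfolding std_def by fastforce+
qed

lemma single_in_std: "i \<in> {1..m} \<Longrightarrow> single i 1 \<in> std"
  using no_ghost n_ge_2 by (fastforce simp: std_def ghost_vertex_def)

lemma monomial_exp_std: "F \<in> \<Delta> \<Longrightarrow> monomial_exp F \<in> std"
  using face_finite[of F] face_verts[of F] n_ge_2
  by (force simp: std_def keys_monomial_exp lookup_monomial_exp)

text \<open>The new variable enters with exponent 1, which is below \<open>n i\<close> because
  \<open>n i \<ge> 2\<close>. So multiplication by it does not kill the monomial in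
  \<open>A\<close>.\<close>

lemma std_add_new_vertex:
  assumes "t \<in> std" "i \<notin> keys t" "insert i (keys t) \<in> \<Delta>"
  shows "single i 1 + t \<in> std"
proof -
  have "i \<in> {1..m}" using assms(3) face_verts by blast
  then have "n i \<ge> 2" using n_ge_2 by blast
  then show ?thesis using assms
    by (auto simp: std_def keys_add_nat lookup_add lookup_single when_def in_keys_iff)
qed

section \<open>The defining ideal as a monomial ideal\<close>

interpretation P: cring "P :: 'k::field mpoly ring"
  by (rule poly_ring_cring)

text \<open>A description of \<open>J\<close> that does not mention generators, proved in
  \<open>defining_ideal_eq\<close>.\<close>

definition vanishing :: "'k::field mpoly set" where
  "vanishing = {p \<in> carrier P. \<forall>t\<in>std. lookup p t = 0}"

lemma uminus_P: "p \<in> carrier P \<Longrightarrow> \<ominus>\<^bsub>P\<^esub> p = - p"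
  by (rule P.minus_equality) (auto simp: uminus_in_carrier)

lemma minus_P: "p \<in> carrier P \<Longrightarrow> q \<in> carrier P \<Longrightarrow> p \<ominus>\<^bsub>P\<^esub> q = p - q"
  by (simp add: a_minus_def uminus_P)

text \<open>A term of the product at a standard \<open>t\<close> would come from a term of
  \<open>p\<close> whose exponent divides \<open>t\<close>; that exponent would be standard, where
  \<open>p\<close> has coefficient zero.\<close>

lemma lookup_times_vanishing:
  assumes "p \<in> vanishing" "t \<in> std" shows "lookup (q * p) t = 0"
proof (rule ccontr)
  assume "lookup (q * p) t \<noteq> 0"
  then have "t \<in> keys (q * p)" by (simp add: in_keys_iff)
  then obtain a b where "t = a + b" "b \<in> keys p"
    using keys_mult[of q p] by blast
  with std_addD(2)[of a b] assms show False by (auto simp: vanishing_def in_keys_iff)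
qed

lemma ideal_vanishing: "ideal (vanishing :: 'k::field mpoly set) P"
proof (rule idealI)
  show "subgroup (vanishing :: 'k mpoly set) (add_monoid P)"
  proof (rule P.add.subgroupI)
    show "(vanishing :: 'k mpoly set) \<subseteq> carrier P"
      by (auto simp: vanishing_def)
    show "(vanishing :: 'k mpoly set) \<noteq> {}"
      using zero_in_carrier by (fastforce simp: vanishing_def)
    show "p \<oplus>\<^bsub>P\<^esub> q \<in> vanishing" if "p \<in> vanishing" "q \<in> vanishing" for p q :: "'k mpoly"
      using that by (simp add: vanishing_def add_in_carrier lookup_add)
    show "\<ominus>\<^bsub>P\<^esub> p \<in> vanishing" if "p \<in> vanishing" for p :: "'k mpoly"
      using that by (simp add: vanishing_def uminus_P uminus_in_carrier)
  qed
  fix p q :: "'k mpoly" assume p: "p \<in> vanishing" and q: "q \<in> carrier P"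
  have *: "q * p \<in> vanishing"
    using lookup_times_vanishing[OF p] p q by (auto simp: vanishing_def times_in_carrier)
  show "q \<otimes>\<^bsub>P\<^esub> p \<in> vanishing" using * by simp
  show "p \<otimes>\<^bsub>P\<^esub> q \<in> vanishing" using * by (simp add: mult.commute)
qed (rule P.ring_axioms)

text \<open>The generators have nonstandard exponents, which gives one inclusion. Conversely every
  nonstandard monomial is a multiple of a generator, and an element of \<open>vanishing\<close> is a
  sum of such terms.\<close>

lemma defining_ideal_eq: "(J :: 'k::field mpoly set) = vanishing"
proof -
  define G1 where "G1 = {\<Prod>i\<in>F. var i :: 'k mpoly | F. F \<subseteq> {1..m} \<and> F \<notin> \<Delta>}"
  define G2 where "G2 = {var i ^ n i :: 'k mpoly | i. i \<in> {1..m}}"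
  have G1: "G1 = {single (monomial_exp F) 1 | F. F \<subseteq> {1..m} \<and> F \<notin> \<Delta>}"
  proof -
    have "(\<Prod>i\<in>F. var i :: 'k mpoly) = single (monomial_exp F) 1" if "F \<subseteq> {1..m}" for F
      using that by (simp add: monomial_exp_def prod_var_eq_single finite_subset)
    then show ?thesis unfolding G1_def by (intro Collect_cong) metis
  qed
  have G2: "G2 = {single (single i (n i)) 1 | i. i \<in> {1..m}}"
    by (simp add: G2_def var_power_eq_single)
  have G1_van: "G1 \<subseteq> vanishing"
  proof
    fix p assume "p \<in> G1"
    then obtain F where F: "F \<subseteq> {1..m}" "F \<notin> \<Delta>" "p = single (monomial_exp F) 1"
      by (auto simp: G1)
    then have "finite F" using finite_subset by blast
    with F show "p \<in> vanishing"
      by (auto simp: vanishing_def std_def lookup_single when_def keys_monomial_exp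
          intro!: single_in_carrier)
  qed
  have G2_van: "G2 \<subseteq> vanishing"
  proof
    fix p assume "p \<in> G2"
    then obtain i where i: "i \<in> {1..m}" "p = single (single i (n i)) 1"
      by (auto simp: G2)
    then have "n i \<ge> 2" using n_ge_2 by blast
    \<comment> \<open>As \<open>n i\<close> is positive, \<open>i\<close> lies in the support of
      this exponent, and there the strict bound fails.\<close>
    then have "single i (n i) \<notin> std"
      by (simp add: std_def)
    with i show "p \<in> vanishing"
      by (auto simp: vanishing_def lookup_single when_def intro!: single_in_carrier split: if_splits)
  qed
  have G1_carr: "G1 \<subseteq> carrier P" and G2_carr: "G2 \<subseteq> carrier P"
    using G1_van G2_van by (auto simp: vanishing_def)
  have J: "J = Idl\<^bsub>P\<^esub> G1 <+>\<^bsub>P\<^esub> Idl\<^bsub>P\<^esub> G2"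
    by (simp add: defining_ideal_def stanley_reisner_ideal_def G1_def G2_def)
  have I1: "ideal (Idl\<^bsub>P\<^esub> G1) P" and I2: "ideal (Idl\<^bsub>P\<^esub> G2) P"
    using G1_carr G2_carr by (auto intro: P.genideal_ideal)
  then have "ideal (J :: 'k mpoly set) P" unfolding J by (rule P.add_ideals)
  then interpret J: ideal "J :: 'k mpoly set" P .
  have zero: "0 \<in> Idl\<^bsub>P\<^esub> G1" "0 \<in> Idl\<^bsub>P\<^esub> G2"
    using additive_subgroup.zero_closed[OF ideal.axioms(1)[OF I1]]
      additive_subgroup.zero_closed[OF ideal.axioms(1)[OF I2]] by auto
  have G1_J: "G1 \<subseteq> J"
  proof
    fix p assume "p \<in> G1"
    then have "p \<in> Idl\<^bsub>P\<^esub> G1" using P.genideal_self[OF G1_carr] by blast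
    then show "p \<in> J" unfolding J set_add_def' using zero by force
  qed
  have G2_J: "G2 \<subseteq> J"
  proof
    fix p assume "p \<in> G2"
    then have "p \<in> Idl\<^bsub>P\<^esub> G2" using P.genideal_self[OF G2_carr] by blast
    then show "p \<in> J" unfolding J set_add_def' using zero by force
  qed
  show ?thesis
  proof
    interpret V: ideal "vanishing :: 'k mpoly set" P by (rule ideal_vanishing)
    show "(J :: 'k mpoly set) \<subseteq> vanishing"
      unfolding J set_add_def'
      using P.genideal_minimal[OF ideal_vanishing G1_van]
        P.genideal_minimal[OF ideal_vanishing G2_van] V.a_closed by auto
    show "vanishing \<subseteq> (J :: 'k mpoly set)"
    proof
      fix p :: "'k mpoly" assume p: "p \<in> vanishing"
      show "p \<in> (J :: 'k mpoly set)"
      proof (rule poly_mapping_induct_keys)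
        show "0 \<in> (J :: 'k mpoly set)" using J.zero_closed by simp
        show "p + q \<in> (J :: 'k mpoly set)" if "p \<in> (J :: 'k mpoly set)" "q \<in> (J :: 'k mpoly set)" for p q
          using J.a_closed[OF that] by simp
        fix t assume t: "t \<in> keys p"
        then have keys_t: "keys t \<subseteq> {1..m}" and "t \<notin> std"
          using p by (auto simp: vanishing_def carrier_poly_ring in_keys_iff)
        \<comment> \<open>It suffices to find a generator dividing the monomial; the cofactor has
          exponent \<open>t - s\<close>, where truncated subtraction is exact.\<close>
        have multiple: "single t (lookup p t) \<in> (J :: 'k mpoly set)"
          if "single s 1 \<in> (J :: 'k mpoly set)" "\<And>i. lookup s i \<le> lookup t i" for s
        proof -
          have t_eq: "t = s + (t - s)"
            using that(2) by (intro poly_mapping_eqI) (simp add: lookup_add lookup_minus)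
          have "keys (t - s) \<subseteq> {1..m}"
            using keys_t by (auto simp: in_keys_iff lookup_minus)
          then have "single (t - s) (lookup p t) \<in> carrier P"
            by (rule single_in_carrier)
          from J.I_r_closed[OF that(1) this] show ?thesis
            using t_eq by (simp add: mult_single)
        qed
        show "single t (lookup p t) \<in> (J :: 'k mpoly set)"
        \<comment> \<open>If the support is a nonface, its squarefree monomial divides; otherwise a
          bound fails at some \<open>i\<close>, and the pure power of that variable divides.\<close>
        proof (cases "keys t \<in> \<Delta>")
          case False
          with keys_t have "single (monomial_exp (keys t)) 1 \<in> (J :: 'k mpoly set)"
            using G1_J G1 by blast
          then show ?thesis
            by (rule multiple) (auto simp: lookup_monomial_exp when_def in_keys_iff)
        next
          case True
          with \<open>t \<notin> std\<close> obtain i where i: "i \<in> keys t" "n i \<le> lookup t i"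
            by (force simp: std_def)
          with keys_t have "single (single i (n i)) 1 \<in> (J :: 'k mpoly set)"
            using G2_J G2 by blast
          then show ?thesis
            by (rule multiple) (use i in \<open>auto simp: lookup_single when_def\<close>)
        qed
      qed
    qed
  qed
qed

lemma ideal_J: "ideal (J :: 'k::field mpoly set) P"
  using ideal_vanishing by (simp add: defining_ideal_eq)

section \<open>Arithmetic and coefficients in the quotient algebra\<close>

interpretation J: ideal "J :: 'k::field mpoly set" P
  by (rule ideal_J)

lemma A_cring: "cring (A :: 'k::field mpoly set ring)"
  unfolding artinian_algebra_def by (rule J.quotient_is_cring) (rule P.cring_axioms)

interpretation A: cring "A :: 'k::field mpoly set ring"
  by (rule A_cring)

lemma carrier_A: "carrier A = cls ` carrier P"
  by (auto simp: artinian_algebra_def residue_class_def FactRing_def A_RCOSETS_def')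

lemma cls_in_carrier [simp]: "p \<in> carrier P \<Longrightarrow> cls p \<in> carrier A"
  by (simp add: carrier_A)

lemma cls_hom: "cls \<in> ring_hom (P :: 'k::field mpoly ring) A"
  using J.rcos_ring_hom unfolding artinian_algebra_def residue_class_def[abs_def] .

lemma cls_add: "p \<in> carrier P \<Longrightarrow> q \<in> carrier P \<Longrightarrow> cls p \<oplus>\<^bsub>A\<^esub> cls q = cls (p + q)"
  using ring_hom_add[OF cls_hom, of p q] by simp

lemma cls_mult: "p \<in> carrier P \<Longrightarrow> q \<in> carrier P \<Longrightarrow> cls p \<otimes>\<^bsub>A\<^esub> cls q = cls (p * q)"
  using ring_hom_mult[OF cls_hom, of p q] by simp

lemma cls_zero: "\<zero>\<^bsub>A\<^esub> = cls (0 :: 'k::field mpoly)"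
  by (rule ring_hom_zero[OF cls_hom P.ring_axioms A.ring_axioms, symmetric, simplified])

text \<open>The difference \<open>p - q\<close> lies in \<open>J\<close> exactly when it has no
  standard terms. This is the linear independence of the standard monomials in
  \<open>A\<close>.\<close>

lemma cls_eq_iff:
  fixes p q :: "'k::field mpoly"
  assumes "p \<in> carrier P" "q \<in> carrier P"
  shows "cls p = cls q \<longleftrightarrow> (\<forall>t\<in>std. lookup p t = lookup q t)"
proof -
  have carr: "p - q \<in> carrier P"
    using add_in_carrier[OF assms(1) uminus_in_carrier[OF assms(2)]] by simp
  have "cls p = cls q \<longleftrightarrow> p - q \<in> J"
    using P.quotient_eq_iff_same_a_r_cos[OF ideal_J assms] minus_P[OF assms]
    by (simp add: residue_class_def)
  also have "\<dots> \<longleftrightarrow> (\<forall>t\<in>std. lookup p t = lookup q t)"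
    unfolding defining_ideal_eq vanishing_def using carr by (auto simp: lookup_minus)
  finally show ?thesis .
qed

text \<open>An arbitrary representative. Only its coefficients at exponents in \<open>std\<close>
  are determined by the class, so \<open>coef\<close> is meaningful only there.\<close>

definition rep :: "'k::field mpoly set \<Rightarrow> 'k mpoly" where
  "rep X = (SOME p. p \<in> carrier P \<and> cls p = X)"

definition coef :: "(nat \<Rightarrow>\<^sub>0 nat) \<Rightarrow> 'k::field mpoly set \<Rightarrow> 'k" where
  "coef t X = lookup (rep X) t"

lemma rep:
  assumes "X \<in> carrier A" shows "rep X \<in> carrier P" "cls (rep X) = X"
proof -
  have "\<exists>p. p \<in> carrier P \<and> cls p = X" using assms by (auto simp: carrier_A)
  then have "rep X \<in> carrier P \<and> cls (rep X) = X" unfolding rep_def by (rule someI_ex)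
  then show "rep X \<in> carrier P" "cls (rep X) = X" by auto
qed

lemma coef_cls:
  assumes "p \<in> carrier P" "t \<in> std"
  shows "coef t (cls p) = lookup p t"
  using rep[OF cls_in_carrier[OF assms(1)]] cls_eq_iff[of "rep (cls p)" p] assms
  by (simp add: coef_def)

lemma cls_eqI:
  assumes "p \<in> carrier P" "q \<in> carrier P" "\<And>t. t \<in> std \<Longrightarrow> lookup p t = lookup q t"
  shows "cls p = cls q"
  using assms by (simp add: cls_eq_iff)

lemma cls_single_eq_zero:
  "keys t \<subseteq> {1..m} \<Longrightarrow> t \<notin> std \<Longrightarrow> cls (single t c) = cls 0"
  by (rule cls_eqI) (auto simp: single_in_carrier zero_in_carrier lookup_single when_def)

lemma cls_uminus: "p \<in> carrier P \<Longrightarrow> \<ominus>\<^bsub>A\<^esub> cls p = cls (- p :: 'k::field mpoly)"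
  by (rule A.minus_equality) (auto simp: uminus_in_carrier cls_add cls_zero)

section \<open>Ideals spanned by monomials\<close>

lemma single_std_in_carrier: "t \<in> std \<Longrightarrow> single t c \<in> carrier P"
  by (rule single_in_carrier) (rule std_keys)

definition mspan :: "(nat \<Rightarrow>\<^sub>0 nat) set \<Rightarrow> 'k::field mpoly set set" where
  "mspan S = {X \<in> carrier A. \<forall>t\<in>std. coef t X \<noteq> 0 \<longrightarrow> t \<in> S}"

lemma cls_in_mspan_iff:
  "p \<in> carrier P \<Longrightarrow> cls p \<in> mspan S \<longleftrightarrow> (\<forall>t\<in>std. lookup p t \<noteq> 0 \<longrightarrow> t \<in> S)"
  by (simp add: mspan_def coef_cls)

lemma mspan_obtain:
  assumes "X \<in> mspan S"
  obtains p where "p \<in> carrier P" "X = cls p" "\<And>t. t \<in> std \<Longrightarrow> lookup p t \<noteq> 0 \<Longrightarrow> t \<in> S"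
  using assms by (auto simp: mspan_def carrier_A coef_cls)

lemma monomial_in_mspan_iff:
  assumes "t \<in> std"
  shows "cls (single t 1 :: 'k::field mpoly) \<in> mspan S \<longleftrightarrow> t \<in> S"
  using assms by (auto simp: cls_in_mspan_iff single_std_in_carrier lookup_single when_def)

text \<open>Closure of \<open>S\<close> under multiples is required only within \<open>std\<close>,
  since all other monomials are zero in \<open>A\<close>.\<close>

lemma mspan_ideal:
  assumes up: "\<And>s t. s \<in> S \<Longrightarrow> s + t \<in> std \<Longrightarrow> s + t \<in> S"
  shows "ideal (mspan S :: 'k::field mpoly set set) A"
proof (rule idealI)
  show "subgroup (mspan S :: 'k mpoly set set) (add_monoid A)"
  proof (rule A.add.subgroupI)
    show "(mspan S :: 'k mpoly set set) \<subseteq> carrier A" by (auto simp: mspan_def)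
    have "cls (0 :: 'k mpoly) \<in> mspan S" by (simp add: cls_in_mspan_iff zero_in_carrier)
    then show "(mspan S :: 'k mpoly set set) \<noteq> {}" by blast
    show "\<ominus>\<^bsub>A\<^esub> X \<in> mspan S" if "X \<in> mspan S" for X :: "'k mpoly set"
      using that by (elim mspan_obtain) (simp add: cls_uminus cls_in_mspan_iff uminus_in_carrier)
    show "X \<oplus>\<^bsub>A\<^esub> Y \<in> mspan S" if XY: "X \<in> mspan S" "Y \<in> mspan S" for X Y :: "'k mpoly set"
    proof -
      obtain p where p: "p \<in> carrier P" "X = cls p"
          "\<And>t. t \<in> std \<Longrightarrow> lookup p t \<noteq> 0 \<Longrightarrow> t \<in> S" using XY(1) by (rule mspan_obtain) blast
      obtain q where q: "q \<in> carrier P" "Y = cls q"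
          "\<And>t. t \<in> std \<Longrightarrow> lookup q t \<noteq> 0 \<Longrightarrow> t \<in> S" using XY(2) by (rule mspan_obtain) blast
      have "lookup p t \<noteq> 0 \<or> lookup q t \<noteq> 0" if "lookup (p + q) t \<noteq> 0" for t
        using that by (auto simp: lookup_add)
      with p q show ?thesis
        by (fastforce simp: cls_add cls_in_mspan_iff add_in_carrier)
    qed
  qed
  fix X Y :: "'k mpoly set" assume X: "X \<in> mspan S" and Y: "Y \<in> carrier A"
  obtain p where p: "p \<in> carrier P" "X = cls p"
      "\<And>t. t \<in> std \<Longrightarrow> lookup p t \<noteq> 0 \<Longrightarrow> t \<in> S" using X by (rule mspan_obtain) blast
  obtain q where q: "q \<in> carrier P" "Y = cls q" using Y by (auto simp: carrier_A)
  have "t \<in> S" if t: "t \<in> std" "lookup (p * q) t \<noteq> 0" for t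
  proof -
    from t have "t \<in> keys (p * q)" by (simp add: in_keys_iff)
    then obtain a b where ab: "t = a + b" "a \<in> keys p" using keys_mult[of p q] by blast
    with t have "a \<in> std" using std_addD(1) by blast
    with ab p(3) have "a \<in> S" by (simp add: in_keys_iff)
    with ab t up show ?thesis by blast
  qed
  then have XY: "X \<otimes>\<^bsub>A\<^esub> Y \<in> mspan S"
    using p q by (simp add: cls_mult cls_in_mspan_iff times_in_carrier)
  then show "X \<otimes>\<^bsub>A\<^esub> Y \<in> mspan S" .
  show "Y \<otimes>\<^bsub>A\<^esub> X \<in> mspan S"
    using XY p q by (simp add: cls_mult mult.commute)
qed (rule A.ring_axioms)

text \<open>Each element of the span is a finite sum of scalar multiples of standard monomials in
  \<open>S\<close>, so an ideal containing these monomials contains the span.\<close>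

lemma mspan_minimal:
  assumes I: "ideal I (A :: 'k::field mpoly set ring)"
    and mon: "\<And>t. t \<in> std \<Longrightarrow> t \<in> S \<Longrightarrow> cls (single t 1 :: 'k mpoly) \<in> I"
  shows "mspan S \<subseteq> I"
proof
  interpret I: ideal I "A :: 'k mpoly set ring" by (rule I)
  fix X :: "'k mpoly set" assume "X \<in> mspan S"
  then obtain p where p: "p \<in> carrier P" "X = cls p"
      "\<And>t. t \<in> std \<Longrightarrow> lookup p t \<noteq> 0 \<Longrightarrow> t \<in> S" by (rule mspan_obtain) blast
  \<comment> \<open>The nonstandard terms of \<open>p\<close> may have exponents outside
    \<open>S\<close>; they are dropped, which does not change the class.\<close>
  let ?q = "restrict_keys std p"
  have "X = cls ?q"
    unfolding p(2)
    by (rule cls_eqI) (simp_all add: p(1) restrict_keys_in_carrier lookup_restrict_keys)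
  moreover have "?q \<in> carrier P \<and> cls ?q \<in> I"
  proof (rule poly_mapping_induct_keys[where Q = "\<lambda>q. q \<in> carrier P \<and> cls q \<in> I"])
    show "0 \<in> carrier P \<and> cls (0 :: 'k mpoly) \<in> I"
      using I.zero_closed by (simp add: cls_zero zero_in_carrier)
    show "q + r \<in> carrier P \<and> cls (q + r) \<in> I"
      if "q \<in> carrier P \<and> cls q \<in> I" "r \<in> carrier P \<and> cls r \<in> I" for q r
      using that I.a_closed[of "cls q" "cls r"] by (simp add: cls_add add_in_carrier)
    fix t assume "t \<in> keys ?q"
    then have t: "t \<in> std" "t \<in> S"
      using p(3) by (auto simp: in_keys_iff lookup_restrict_keys when_def split: if_splits)
    \<comment> \<open>The coefficient is viewed as a constant polynomial, so that absorption by the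
      ideal supplies closure under scalars.\<close>
    let ?c = "single 0 (lookup ?q t) :: 'k mpoly"
    have c: "?c \<in> carrier P" by (rule single_in_carrier) simp
    have "cls ?c \<otimes>\<^bsub>A\<^esub> cls (single t 1) \<in> I"
      by (rule I.I_l_closed[OF mon[OF t] cls_in_carrier[OF c]])
    then show "single t (lookup ?q t) \<in> carrier P \<and> cls (single t (lookup ?q t)) \<in> I"
      by (simp add: cls_mult c single_std_in_carrier t mult_single)
  qed
  ultimately show "X \<in> I" by simp
qed

text \<open>Testing on single monomials reduces a comparison of ideals to one of sets of
  exponents.\<close>

lemma mspan_subset_iff:
  "(mspan S :: 'k::field mpoly set set) \<subseteq> mspan T \<longleftrightarrow> S \<inter> std \<subseteq> T"
proof
  assume sub: "(mspan S :: 'k mpoly set set) \<subseteq> mspan T"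
  show "S \<inter> std \<subseteq> T"
  proof
    fix t assume t: "t \<in> S \<inter> std"
    then have "cls (single t 1 :: 'k mpoly) \<in> mspan S" by (simp add: monomial_in_mspan_iff)
    with sub have "cls (single t 1 :: 'k mpoly) \<in> mspan T" by blast
    with t show "t \<in> T" by (simp add: monomial_in_mspan_iff)
  qed
qed (auto simp: mspan_def)

section \<open>Degree and powers of the maximal ideal\<close>

definition deg :: "(nat \<Rightarrow>\<^sub>0 nat) \<Rightarrow> nat" where
  "deg t = (\<Sum>i\<in>{1..m}. lookup t i)"

lemma deg_add: "deg (s + t) = deg s + deg t"
  by (simp add: deg_def lookup_add sum.distrib)

lemma deg_single: "i \<in> {1..m} \<Longrightarrow> deg (single i k) = k"
  by (simp add: deg_def lookup_single when_def)

lemma deg_monomial_exp: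
  assumes "F \<in> \<Delta>" shows "deg (monomial_exp F) = card F"
proof -
  have "deg (monomial_exp F) = (\<Sum>i\<in>{1..m}. if i \<in> F then 1 else 0)"
    unfolding deg_def
    by (rule sum.cong) (simp_all add: lookup_monomial_exp face_finite[OF assms] when_def)
  also have "\<dots> = card ({1..m} \<inter> F)" by (simp add: sum.If_cases)
  also have "{1..m} \<inter> F = F" using face_verts[OF assms] by blast
  finally show ?thesis .
qed

lemma deg_split:
  assumes "t \<in> std" "deg t \<ge> Suc k"
  obtains i s where "i \<in> {1..m}" "t = s + single i 1" "deg s \<ge> k"
proof -
  from assms(2) have "deg t \<noteq> 0" by simp
  then obtain i where i: "i \<in> {1..m}" "lookup t i \<noteq> 0" by (auto simp: deg_def)
  have t: "t = (t - single i 1) + single i 1"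
    using i by (intro poly_mapping_eqI) (auto simp: lookup_add lookup_minus lookup_single when_def)
  have "deg t = deg (t - single i 1) + 1"
    by (subst t) (simp only: deg_add deg_single[OF i(1)])
  with assms(2) have "deg (t - single i 1) \<ge> k" by simp
  with i(1) t show thesis by (rule that)
qed

lemma ideal_mspan_deg: "ideal (mspan {t. deg t \<ge> k} :: 'k::field mpoly set set) A"
  by (rule mspan_ideal) (simp add: deg_add)

lemma graded_maximal_ideal_eq:
  "graded_maximal_ideal m \<Delta> n = (mspan {t. deg t \<ge> 1} :: 'k::field mpoly set set)"
proof -
  let ?G = "(\<lambda>i. cls (var i :: 'k mpoly)) ` {1..m}"
  have var: "cls (var i :: 'k mpoly) \<in> mspan {t. deg t \<ge> 1}" if "i \<in> {1..m}" for i
    using that unfolding var_def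
    by (simp add: monomial_in_mspan_iff single_in_std[simplified] deg_single)
  then have G: "?G \<subseteq> carrier A" by (auto simp: mspan_def)
  interpret G: ideal "Idl\<^bsub>A\<^esub> ?G" "A :: 'k mpoly set ring" by (rule A.genideal_ideal[OF G])
  show ?thesis unfolding graded_maximal_ideal_def
  proof
    show "Idl\<^bsub>A\<^esub> ?G \<subseteq> mspan {t. deg t \<ge> 1}"
      using var by (intro A.genideal_minimal ideal_mspan_deg) auto
    show "mspan {t. deg t \<ge> 1} \<subseteq> Idl\<^bsub>A\<^esub> ?G"
    proof (rule mspan_minimal[OF G.ideal_axioms])
      fix t assume t: "t \<in> std" "t \<in> {t. deg t \<ge> 1}"
      then have "deg t \<ge> Suc 0" by simp
      with t(1) obtain i s where i: "i \<in> {1..m}" "t = s + single i 1"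
        by (rule deg_split)
      then have s: "s \<in> std" using t(1) std_addD(1) by blast
      have "cls (var i :: 'k mpoly) \<in> Idl\<^bsub>A\<^esub> ?G"
        using A.genideal_self[OF G] i(1) by blast
      from G.I_l_closed[OF this, of "cls (single s 1)"]
      show "cls (single t 1 :: 'k mpoly) \<in> Idl\<^bsub>A\<^esub> ?G"
        using i s by (simp add: cls_mult single_std_in_carrier single_in_std[simplified] var_def mult_single)
    qed
  qed
qed

text \<open>By induction on \<open>q\<close>: degrees add in a product, and conversely a standard
  monomial of degree at least \<open>q + 1\<close> is a variable times a standard monomial of degree
  at least \<open>q\<close>.\<close>

lemma graded_maximal_ideal_power:
  "graded_maximal_ideal m \<Delta> n [^]\<^bsub>ideals_set A\<^esub> (q::nat)
    = (mspan {t. deg t \<ge> q} :: 'k::field mpoly set set)"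
proof (induction q)
  case 0
  \<comment> \<open>The zeroth power is the whole ring, which is the span of the standard monomials
    of degree at least 0.\<close>
  show ?case by (auto simp: nat_pow_def ideals_set_def mspan_def)
next
  case (Suc q)
  let ?M = "\<lambda>k. mspan {t. deg t \<ge> k} :: 'k mpoly set set"
  have "graded_maximal_ideal m \<Delta> n [^]\<^bsub>ideals_set A\<^esub> Suc q = ?M q \<cdot>\<^bsub>A\<^esub> ?M 1"
    using Suc.IH by (simp add: nat_pow_def ideals_set_def graded_maximal_ideal_eq)
  also have "\<dots> = ?M (Suc q)"
  proof
    interpret M: ideal "?M (Suc q)" A by (rule ideal_mspan_deg)
    show "?M q \<cdot>\<^bsub>A\<^esub> ?M 1 \<subseteq> ?M (Suc q)"
    proof
      fix X :: "'k mpoly set" assume "X \<in> ?M q \<cdot>\<^bsub>A\<^esub> ?M 1"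
      then show "X \<in> ?M (Suc q)"
      proof (induction rule: ideal_prod.induct)
        case (prod X Y)
        obtain p where p: "p \<in> carrier P" "X = cls p"
          "\<And>t. t \<in> std \<Longrightarrow> lookup p t \<noteq> 0 \<Longrightarrow> t \<in> {t. deg t \<ge> q}"
          using prod(1) by (rule mspan_obtain) blast
        obtain r where r: "r \<in> carrier P" "Y = cls r"
          "\<And>t. t \<in> std \<Longrightarrow> lookup r t \<noteq> 0 \<Longrightarrow> t \<in> {t. deg t \<ge> 1}"
          using prod(2) by (rule mspan_obtain) blast
        have "deg t \<ge> Suc q" if t: "t \<in> std" "lookup (p * r) t \<noteq> 0" for t
        proof -
          from t have "t \<in> keys (p * r)" by (simp add: in_keys_iff)
          then obtain a b where ab: "t = a + b" "a \<in> keys p" "b \<in> keys r"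
            using keys_mult[of p r] by blast
          with t have "a \<in> std" "b \<in> std" using std_addD by blast+
          with ab p(3)[of a] r(3)[of b] show ?thesis by (simp add: in_keys_iff deg_add)
        qed
        with p r show ?case by (simp add: cls_mult cls_in_mspan_iff times_in_carrier)
      next
        case (sum X Y)
        then show ?case using M.a_closed by blast
      qed
    qed
    show "?M (Suc q) \<subseteq> ?M q \<cdot>\<^bsub>A\<^esub> ?M 1"
    proof (rule mspan_minimal[OF A.ideal_prod_is_ideal[OF ideal_mspan_deg ideal_mspan_deg]])
      fix t assume t: "t \<in> std" "t \<in> {t. deg t \<ge> Suc q}"
      then have "deg t \<ge> Suc q" by simp
      with t(1) obtain i s where i: "i \<in> {1..m}" "t = s + single i 1" "deg s \<ge> q"
        by (rule deg_split)
      then have s: "s \<in> std" using t(1) std_addD(1) by blast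
      have "cls (single s 1 :: 'k mpoly) \<in> ?M q" "cls (single (single i 1) 1 :: 'k mpoly) \<in> ?M 1"
        using i s by (simp_all add: monomial_in_mspan_iff single_in_std[simplified] deg_single)
      from ideal_prod.prod[OF this, of A]
      show "cls (single t 1 :: 'k mpoly) \<in> ?M q \<cdot>\<^bsub>A\<^esub> ?M 1"
        using i s by (simp add: cls_mult single_std_in_carrier single_in_std[simplified] mult_single)
    qed
  qed
  finally show ?case .
qed

section \<open>The canonical trace of a flag complex\<close>

abbreviation \<omega> :: "('k::field mpoly set, 'k mpoly set \<Rightarrow> 'k) module" where
  "\<omega> \<equiv> canonical_module (\<lambda>c. cls (const c)) A"

section \<open>Functionals on \<open>A\<close> and their module operations\<close>

lemma const_in_carrier: "const c \<in> carrier P"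
  by (simp add: const_def single_in_carrier)

lemma var_in_carrier: "i \<in> {1..m} \<Longrightarrow> var i \<in> carrier P"
  by (simp add: var_def single_in_carrier)

text \<open>Linearity is expressed on polynomial representatives, where sums and products can be
  computed by coefficients.\<close>

lemma omega_carrier_iff:
  fixes l :: "'k::field mpoly set \<Rightarrow> 'k"
  shows "l \<in> carrier \<omega> \<longleftrightarrow> l \<in> extensional (carrier A) \<and>
    (\<forall>p\<in>carrier P. \<forall>q\<in>carrier P. l (cls (p + q)) = l (cls p) + l (cls q)) \<and>
    (\<forall>c. \<forall>p\<in>carrier P. l (cls (const c * p)) = c * l (cls p))"
  by (simp add: canonical_module_def carrier_A ball_simps cls_add cls_mult const_in_carrier
      cong: ball_cong)

lemma omega_extensional: "l \<in> carrier \<omega> \<Longrightarrow> l \<in> extensional (carrier A)"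
  by (simp add: omega_carrier_iff)

lemma omega_add: "l \<in> carrier \<omega> \<Longrightarrow> p \<in> carrier P \<Longrightarrow> q \<in> carrier P
    \<Longrightarrow> l (cls (p + q)) = l (cls p) + l (cls q)"
  by (simp add: omega_carrier_iff)

lemma omega_scale: "l \<in> carrier \<omega> \<Longrightarrow> p \<in> carrier P \<Longrightarrow> l (cls (const c * p)) = c * l (cls p)"
  by (simp add: omega_carrier_iff)

lemma omega_zero: "l \<in> carrier \<omega> \<Longrightarrow> l (cls 0) = 0"
  using omega_scale[of l 0 0] by (simp add: zero_in_carrier)

lemma omega_add_cls:
  "p \<in> carrier P \<Longrightarrow> (l \<oplus>\<^bsub>\<omega>\<^esub> l') (cls p) = l (cls p) + l' (cls p)"
  by (simp add: canonical_module_def)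

lemma omega_smult_cls:
  "p \<in> carrier P \<Longrightarrow> q \<in> carrier P \<Longrightarrow> (cls q \<odot>\<^bsub>\<omega>\<^esub> l) (cls p) = l (cls (q * p))"
  by (simp add: canonical_module_def cls_mult)

lemma omega_ops_extensional:
  "l \<oplus>\<^bsub>\<omega>\<^esub> l' \<in> extensional (carrier A)" "X \<odot>\<^bsub>\<omega>\<^esub> l \<in> extensional (carrier A)"
  by (simp_all add: canonical_module_def)

lemma omega_eqI:
  assumes "l \<in> extensional (carrier A)" "l' \<in> extensional (carrier A)"
    and "\<And>p. p \<in> carrier P \<Longrightarrow> l (cls p) = l' (cls p)"
  shows "l = l'"
  using assms by (intro extensionalityI[of l "carrier A" l']) (auto simp: carrier_A)

lemma omega_add_closed:
  "l \<in> carrier \<omega> \<Longrightarrow> l' \<in> carrier \<omega> \<Longrightarrow> l \<oplus>\<^bsub>\<omega>\<^esub> l' \<in> carrier \<omega>"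
  unfolding omega_carrier_iff[of "l \<oplus>\<^bsub>\<omega>\<^esub> l'"]
  by (simp add: omega_ops_extensional omega_add_cls add_in_carrier times_in_carrier
      const_in_carrier omega_add omega_scale distrib_left)

lemma omega_smult_closed:
  assumes "l \<in> carrier \<omega>" "q \<in> carrier P" shows "cls q \<odot>\<^bsub>\<omega>\<^esub> l \<in> carrier \<omega>"
proof -
  have "l (cls (q * (const c * p))) = c * l (cls (q * p))" if "p \<in> carrier P" for c p
    using omega_scale[OF assms(1), of "q * p" c] assms(2) that
    by (simp add: times_in_carrier mult.left_commute)
  with assms show ?thesis
    unfolding omega_carrier_iff[of "cls q \<odot>\<^bsub>\<omega>\<^esub> l"]
    by (simp add: omega_ops_extensional omega_smult_cls add_in_carrier times_in_carrier
      const_in_carrier omega_add distrib_left)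
qed

section \<open>Free faces in a flag complex\<close>

lemma face_in_facet:
  assumes "F \<in> \<Delta>" obtains G where "facet \<Delta> G" "F \<subseteq> G"
  using finite_has_maximal2[OF finite_complex assms] by (auto simp: facet_def)

text \<open>A facet containing \<open>F'\<close> also contains \<open>F\<close>, so uniqueness is
  inherited; existence holds for every face.\<close>

lemma free_face_mono:
  assumes "free_face \<Delta> F" "F \<subseteq> F'" "F' \<in> \<Delta>" shows "free_face \<Delta> F'"
proof -
  obtain G where "facet \<Delta> G" "F' \<subseteq> G" using assms(3) by (rule face_in_facet)
  moreover have "G1 = G2" if "facet \<Delta> G1" "F' \<subseteq> G1" "facet \<Delta> G2" "F' \<subseteq> G2" for G1 G2
    using assms(1,2) that unfolding free_face_def by blast
  ultimately show ?thesis using assms(3) unfolding free_face_def by blast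
qed

text \<open>Otherwise \<open>F\<close> and the vertices of its link would span a clique, which would then be the only
  facet containing \<open>F\<close>.\<close>

lemma not_free_obtains_nonedge:
  assumes "flag \<Delta>" "F \<in> \<Delta>" "\<not> free_face \<Delta> F"
  obtains i j where "i \<notin> F" "insert i F \<in> \<Delta>" "j \<notin> F" "insert j F \<in> \<Delta>" "i \<noteq> j" "{i, j} \<notin> \<Delta>"
proof -
  define V where "V = {i. insert i F \<in> \<Delta>}"
  have "F \<subseteq> V" using assms(2) by (auto simp: V_def insert_absorb)
  have V_top: "G \<subseteq> V" if "G \<in> \<Delta>" "F \<subseteq> G" for G
    using that face_subset[OF that(1)] by (auto simp: V_def)
  have "V \<notin> \<Delta>"
  proof
    assume "V \<in> \<Delta>"
    have "G = V" if "facet \<Delta> G" "F \<subseteq> G" for G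
      using that V_top[of G] \<open>V \<in> \<Delta>\<close> by (auto simp: facet_def)
    moreover have "facet \<Delta> V"
      using V_top \<open>V \<in> \<Delta>\<close> \<open>F \<subseteq> V\<close> unfolding facet_def by blast
    ultimately show False
      using assms(2,3) \<open>F \<subseteq> V\<close> unfolding free_face_def by blast
  qed
  with assms(1) have "\<not> skeleton_clique \<Delta> V" unfolding flag_def by blast
  moreover have "{i} \<in> \<Delta>" if "i \<in> V" for i
    using that face_subset[of "insert i F" "{i}"] by (simp add: V_def)
  ultimately obtain i j where ij: "i \<in> V" "j \<in> V" "i \<noteq> j" "{i, j} \<notin> \<Delta>"
    unfolding skeleton_clique_def skeleton_verts_def skeleton_edges_def ghost_vertex_def by fastforce
  \<comment> \<open>If \<open>i\<close> were in \<open>F\<close>, then \<open>{i, j}\<close> would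
    lie in the face \<open>insert j F\<close>; the argument for \<open>j\<close> is
    symmetric.\<close>
  have "i \<notin> F" using ij face_subset[of "insert j F" "{i, j}"] by (auto simp: V_def)
  moreover have "j \<notin> F" using ij face_subset[of "insert i F" "{i, j}"] by (auto simp: V_def)
  ultimately show thesis using that ij by (auto simp: V_def)
qed

section \<open>Upper bound for the trace\<close>

definition restrict_functional ::
    "(nat \<Rightarrow>\<^sub>0 nat) set \<Rightarrow> ('k::field mpoly set \<Rightarrow> 'k) \<Rightarrow> 'k mpoly set \<Rightarrow> 'k" where
  "restrict_functional S l = (\<lambda>X\<in>carrier A. l (cls (restrict_keys S (rep X))))"

text \<open>Two representatives of a class agree on \<open>std\<close>, hence so do their
  restrictions to \<open>S\<close>; the choice made by \<open>rep\<close> is therefore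
  immaterial.\<close>

lemma restrict_functional_cls:
  fixes p :: "'k::field mpoly"
  assumes p: "p \<in> carrier P"
  shows "restrict_functional S l (cls p) = l (cls (restrict_keys S p))"
proof -
  have r: "rep (cls p) \<in> carrier P" "cls (rep (cls p)) = cls p"
    using rep[OF cls_in_carrier[OF p]] by auto
  then have "\<forall>t\<in>std. lookup (rep (cls p)) t = lookup p t"
    using cls_eq_iff p by blast
  then have "cls (restrict_keys S (rep (cls p))) = cls (restrict_keys S p)"
    using r p by (intro cls_eqI) (simp_all add: restrict_keys_in_carrier lookup_restrict_keys)
  then show ?thesis by (simp add: restrict_functional_def p)
qed

lemma restrict_functional_in_omega:
  assumes "l \<in> carrier \<omega>" shows "restrict_functional S l \<in> carrier \<omega>"
proof -
  have "restrict_keys S (p + q) = restrict_keys S p + restrict_keys S q" for p q :: "'a mpoly"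
    by (rule poly_mapping_eqI) (simp add: lookup_restrict_keys lookup_add when_def)
  moreover have "restrict_keys S (const c * p) = const c * restrict_keys S p" for c and p :: "'a mpoly"
    by (rule poly_mapping_eqI) (simp add: lookup_restrict_keys lookup_const_times when_def)
  ultimately show ?thesis
    unfolding omega_carrier_iff[of "restrict_functional S l"] using assms
    by (simp add: restrict_functional_cls add_in_carrier times_in_carrier const_in_carrier
        restrict_keys_in_carrier omega_add omega_scale)
      (simp add: restrict_functional_def)
qed

lemma restrict_functional_split:
  assumes "l \<in> carrier \<omega>"
  shows "restrict_functional S l \<oplus>\<^bsub>\<omega>\<^esub> restrict_functional (- S) l = l"
proof (rule omega_eqI)
  fix p :: "'a mpoly" assume p: "p \<in> carrier P"
  have "restrict_keys S p + restrict_keys (- S) p = p"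
    by (rule poly_mapping_eqI) (simp add: lookup_restrict_keys lookup_add when_def)
  then show "(restrict_functional S l \<oplus>\<^bsub>\<omega>\<^esub> restrict_functional (- S) l) (cls p) = l (cls p)"
    using omega_add[OF assms, of "restrict_keys S p" "restrict_keys (- S) p"] p
    by (simp add: omega_add_cls restrict_functional_cls restrict_keys_in_carrier)
qed (simp_all add: omega_ops_extensional omega_extensional assms)

text \<open>Every term of \<open>x_i p\<close> has \<open>i\<close> in its support, so no standard
  exponent of it lies in \<open>S\<close>, and the restriction to \<open>S\<close> is zero in
  \<open>A\<close>.\<close>

lemma var_smult_restrict_functional:
  assumes l: "l \<in> carrier \<omega>" and i: "i \<in> {1..m}"
    and S: "\<And>t. t \<in> S \<Longrightarrow> t \<in> std \<Longrightarrow> i \<notin> keys t"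
    and p: "p \<in> carrier P"
  shows "(cls (var i) \<odot>\<^bsub>\<omega>\<^esub> restrict_functional S l) (cls p) = 0"
proof -
  have vp: "var i * p \<in> carrier P" by (simp add: times_in_carrier var_in_carrier[OF i] p)
  have "lookup (var i * p) t = 0" if "t \<in> S" "t \<in> std" for t
  proof (rule ccontr)
    assume "lookup (var i * p) t \<noteq> 0"
    then have "t \<in> keys (var i * p)" by (simp add: in_keys_iff)
    then obtain s where "t = single i 1 + s"
      using keys_single_times unfolding var_def by blast
    then have "i \<in> keys t" by (simp add: keys_add_nat)
    with S that show False by blast
  qed
  then have "cls (restrict_keys S (var i * p)) = cls 0"
    using vp by (intro cls_eqI) (auto simp: restrict_keys_in_carrier zero_in_carrier lookup_restrict_keys when_def)
  then show ?thesis
    using p vp by (simp add: omega_smult_cls var_in_carrier[OF i] restrict_functional_cls omega_zero[OF l])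
qed

text \<open>From \<open>x_i l = 0\<close> it follows that \<open>x_i\<close> kills
  \<open>\<phi> l\<close>. The coefficient of \<open>\<phi> l\<close> at \<open>u\<close> is that of
  the product at the standard exponent \<open>single i 1 + u\<close>, so it is zero.\<close>

lemma coef_eq_zero_of_annihilated:
  fixes \<phi> :: "('k::field mpoly set \<Rightarrow> 'k) \<Rightarrow> 'k mpoly set"
  assumes \<phi>: "\<phi> \<in> module_Hom A \<omega> (regular_module A)" and l: "l \<in> carrier \<omega>"
    and zero: "\<And>p. p \<in> carrier P \<Longrightarrow> (cls (var i) \<odot>\<^bsub>\<omega>\<^esub> l) (cls p) = 0"
    and u: "u \<in> std" "i \<notin> keys u" "insert i (keys u) \<in> \<Delta>"
  shows "coef u (\<phi> l) = 0"
proof -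
  have i: "i \<in> {1..m}" using face_verts[OF u(3)] by blast
  have \<phi>_smult: "\<phi> (cls q \<odot>\<^bsub>\<omega>\<^esub> l) = cls q \<otimes>\<^bsub>A\<^esub> \<phi> l" if "q \<in> carrier P" for q
    using \<phi> l that by (simp add: module_Hom_def regular_module_def)
  have "\<phi> l \<in> carrier A"
    using \<phi> l by (auto simp: module_Hom_def regular_module_def)
  then obtain p where p: "p \<in> carrier P" "\<phi> l = cls p" by (auto simp: carrier_A)
  \<comment> \<open>Writing the zero functional as a multiple of \<open>l\<close> lets the
    compatibility of \<open>\<phi>\<close> with scalars show that its image is zero.\<close>
  have "cls (var i) \<odot>\<^bsub>\<omega>\<^esub> l = cls 0 \<odot>\<^bsub>\<omega>\<^esub> l"
    using zero
    by (intro omega_eqI) (simp_all add: omega_ops_extensional omega_smult_cls zero_in_carrier omega_zero[OF l])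
  then have "cls (var i * p) = cls (0 * p)"
    using \<phi>_smult[OF var_in_carrier[OF i]] \<phi>_smult[OF zero_in_carrier] p
    by (simp add: cls_mult var_in_carrier[OF i] zero_in_carrier)
  then have "lookup (var i * p) (single i 1 + u) = 0"
    using std_add_new_vertex[OF u] cls_eq_iff[of "var i * p" 0] p
    by (simp add: zero_in_carrier times_in_carrier var_in_carrier[OF i])
  then show ?thesis
    unfolding var_def lookup_single_times_add using p u(1) by (simp add: coef_cls)
qed

lemma coef_hom_omega_eq_zero:
  fixes \<phi> :: "('k::field mpoly set \<Rightarrow> 'k) \<Rightarrow> 'k mpoly set"
  assumes "flag \<Delta>" and \<phi>: "\<phi> \<in> module_Hom A \<omega> (regular_module A)" and l: "l \<in> carrier \<omega>"
    and u: "u \<in> std" "\<not> free_face \<Delta> (keys u)"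
  shows "coef u (\<phi> l) = 0"
proof -
  have "keys u \<in> \<Delta>" using u(1) by (simp add: std_def)
  from not_free_obtains_nonedge[OF assms(1) this u(2)]
  obtain i j where ij: "i \<notin> keys u" "insert i (keys u) \<in> \<Delta>" "j \<notin> keys u" "insert j (keys u) \<in> \<Delta>"
    and nonedge: "{i, j} \<notin> \<Delta>" by metis
  have verts: "i \<in> {1..m}" "j \<in> {1..m}"
    using face_verts[OF ij(2)] face_verts[OF ij(4)] by auto
  \<comment> \<open>Exponents in \<open>S\<close> avoid \<open>i\<close>. A standard exponent
    outside \<open>S\<close> involves \<open>i\<close>, hence avoids \<open>j\<close>, as
    \<open>{i, j}\<close> is not a face. So \<open>x_i\<close> and \<open>x_j\<close> kill the two
    parts of \<open>l\<close>.\<close>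
  define S where "S = {t :: nat \<Rightarrow>\<^sub>0 nat. i \<notin> keys t}"
  have S: "i \<notin> keys t" if "t \<in> S" for t using that by (simp add: S_def)
  have S': "j \<notin> keys t" if "t \<in> - S" "t \<in> std" for t
    using that nonedge face_subset[of "keys t" "{i, j}"] by (auto simp: S_def std_def)
  let ?l1 = "restrict_functional S l" and ?l2 = "restrict_functional (- S) l"
  have l1: "?l1 \<in> carrier \<omega>" and l2: "?l2 \<in> carrier \<omega>"
    using restrict_functional_in_omega[OF l] by auto
  have z1: "coef u (\<phi> ?l1) = 0"
    by (rule coef_eq_zero_of_annihilated[OF \<phi> l1 _ u(1) ij(1,2)])
      (rule var_smult_restrict_functional[OF l verts(1) S])
  have z2: "coef u (\<phi> ?l2) = 0"
    by (rule coef_eq_zero_of_annihilated[OF \<phi> l2 _ u(1) ij(3,4)])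
      (rule var_smult_restrict_functional[OF l verts(2) S'])
  have "\<phi> ?l1 \<in> carrier A" "\<phi> ?l2 \<in> carrier A"
    using \<phi> l1 l2 by (auto simp: module_Hom_def regular_module_def)
  then obtain p q where p: "p \<in> carrier P" "\<phi> ?l1 = cls p" and q: "q \<in> carrier P" "\<phi> ?l2 = cls q"
    by (auto simp: carrier_A)
  have "\<phi> (?l1 \<oplus>\<^bsub>\<omega>\<^esub> ?l2) = \<phi> ?l1 \<oplus>\<^bsub>A\<^esub> \<phi> ?l2"
    using \<phi> l1 l2 by (simp add: module_Hom_def regular_module_def)
  then have "\<phi> l = cls (p + q)"
    using p q by (simp add: restrict_functional_split[OF l] cls_add)
  then show ?thesis
    using z1 z2 p q u(1) by (simp add: coef_cls add_in_carrier lookup_add)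
qed

lemma ideal_mspan_free: "ideal (mspan {t. free_face \<Delta> (keys t)} :: 'k::field mpoly set set) A"
proof (rule mspan_ideal)
  fix s t assume "s \<in> {t. free_face \<Delta> (keys t)}" "s + t \<in> std"
  then show "s + t \<in> {t. free_face \<Delta> (keys t)}"
    using free_face_mono[of "keys s" "keys (s + t)"] by (simp add: std_def keys_add_nat)
qed

lemma trace_subset_mspan_free:
  assumes "flag \<Delta>"
  shows "trace_ideal (A :: 'k::field mpoly set ring) \<omega> \<subseteq> mspan {t. free_face \<Delta> (keys t)}"
  unfolding trace_ideal_def
proof (rule A.genideal_minimal[OF ideal_mspan_free], safe)
  fix \<phi> :: "('k mpoly set \<Rightarrow> 'k) \<Rightarrow> 'k mpoly set" and l :: "'k mpoly set \<Rightarrow> 'k"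
  assume \<phi>: "\<phi> \<in> module_Hom A \<omega> (regular_module A)" and l: "l \<in> carrier \<omega>"
  then have "\<phi> l \<in> carrier A"
    by (auto simp: module_Hom_def regular_module_def)
  then show "\<phi> l \<in> mspan {t. free_face \<Delta> (keys t)}"
    using coef_hom_omega_eq_zero[OF assms \<phi> l] by (auto simp: mspan_def)
qed

end

section \<open>The homomorphism attached to a free face\<close>

locale free_face_in_facet = artinian_stanley_reisner +
  fixes H G :: "nat set"
  assumes facet_G: "facet \<Delta> G" and H_sub: "H \<subseteq> G"
    and G_unique: "\<And>G'. facet \<Delta> G' \<Longrightarrow> H \<subseteq> G' \<Longrightarrow> G' = G"
begin

interpretation A: cring "A :: 'k::field mpoly set ring"
  by (rule A_cring)

text \<open>The exponent of the socle monomial of the facet \<open>G\<close>.\<close>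

definition top_exp :: "nat \<Rightarrow>\<^sub>0 nat" where
  "top_exp = (\<Sum>i\<in>G. single i (n i - 1))"

text \<open>By \<open>box_std\<close>, \<open>box_keys\<close> and \<open>in_boxI\<close>, these are
  exactly the exponents of the standard monomials divisible by \<open>x_H\<close>.\<close>

definition box :: "(nat \<Rightarrow>\<^sub>0 nat) set" where
  "box = {w. \<forall>i. lookup (monomial_exp H) i \<le> lookup w i \<and> lookup w i \<le> lookup top_exp i}"

text \<open>The point reflection of the box, which exchanges its two corners; on the box the
  truncated subtraction is exact.\<close>

definition reflect :: "(nat \<Rightarrow>\<^sub>0 nat) \<Rightarrow> nat \<Rightarrow>\<^sub>0 nat" where
  "reflect w = monomial_exp H + top_exp - w"

text \<open>The coefficient map of the homomorphism from the canonical module to \<open>A\<close> given by the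
  element \<open>\<Sum>w\<in>box. x\<^sup>w \<otimes> x\<^sup>d\<^sup>-\<^sup>w\<close> of \<open>A \<otimes> A\<close>, where \<open>d\<close> is the sum of the two corners
  of the box.\<close>

definition box_poly :: "('k::field mpoly \<Rightarrow> 'k) \<Rightarrow> 'k mpoly" where
  "box_poly g = (\<Sum>w\<in>box. single w (g (single (reflect w) 1)))"

lemma G_face: "G \<in> \<Delta>"
  using facet_G by (simp add: facet_def)

lemma H_face: "H \<in> \<Delta>"
  using G_face H_sub by (rule face_subset)

lemma lookup_top_exp: "lookup top_exp i = (n i - 1 when i \<in> G)"
  by (simp add: top_exp_def lookup_sum lookup_single when_def sum.delta face_finite[OF G_face])

lemma lookup_H: "lookup (monomial_exp H) i = (1 when i \<in> H)"
  by (simp add: lookup_monomial_exp face_finite[OF H_face])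

lemma n_G: "i \<in> G \<Longrightarrow> n i \<ge> 2"
  using n_ge_2 face_verts[OF G_face] by blast

lemma H_le_top: "lookup (monomial_exp H) i \<le> lookup top_exp i"
  using n_G[of i] H_sub by (auto simp: lookup_H lookup_top_exp when_def)

lemma H_in_box: "monomial_exp H \<in> box" and top_in_box: "top_exp \<in> box"
  using H_le_top by (auto simp: box_def)

lemma box_std: "w \<in> box \<Longrightarrow> w \<in> std"
  and box_keys: "w \<in> box \<Longrightarrow> H \<subseteq> keys w"
proof -
  assume w: "w \<in> box"
  have le: "lookup w i \<le> (n i - 1 when i \<in> G)" for i
    using w by (simp add: box_def lookup_top_exp)
  have "keys w \<subseteq> G"
  proof
    fix i assume "i \<in> keys w"
    with le[of i] show "i \<in> G" by (auto simp: in_keys_iff when_def split: if_splits)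
  qed
  moreover have "lookup w i < n i" if "i \<in> G" for i
    using le[of i] n_G[OF that] that by simp
  ultimately show "w \<in> std"
    using face_subset[OF G_face] by (auto simp: std_def)
  show "H \<subseteq> keys w"
  proof
    fix i assume "i \<in> H"
    then have "1 \<le> lookup w i" using w by (auto simp: box_def lookup_H dest: spec[of _ i])
    then show "i \<in> keys w" by (simp add: in_keys_iff)
  qed
qed

text \<open>Uniqueness of the facet enters here: the support of \<open>w\<close> lies in some facet,
  which contains \<open>H\<close> and hence is \<open>G\<close>.\<close>

lemma in_boxI:
  assumes "w \<in> std" "H \<subseteq> keys w" shows "w \<in> box"
proof -
  have "keys w \<in> \<Delta>" using assms(1) by (simp add: std_def)
  then obtain G' where G': "facet \<Delta> G'" "keys w \<subseteq> G'" by (rule face_in_facet)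
  with assms(2) G_unique[of G'] have sub: "keys w \<subseteq> G" by blast
  show ?thesis unfolding box_def
  proof (safe)
    fix i
    show "lookup (monomial_exp H) i \<le> lookup w i"
      using assms(2) by (auto simp: lookup_H when_def in_keys_iff Suc_le_eq)
    show "lookup w i \<le> lookup top_exp i"
    proof (cases "i \<in> keys w")
      case True
      with std_lessD[OF assms(1) True] sub show ?thesis by (auto simp: lookup_top_exp)
    qed (simp add: in_keys_iff)
  qed
qed

lemma finite_box: "finite box"
proof -
  \<comment> \<open>The coordinates of exponents in the box are bounded by the largest
    \<open>n i\<close> with \<open>i\<close> in \<open>G\<close> and vanish off
    \<open>G\<close>.\<close>
  have "finite {f. \<forall>i. (i \<in> G \<longrightarrow> f i \<in> {..Max (n ` G)}) \<and> (i \<notin> G \<longrightarrow> f i = (0::nat))}"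
    by (rule finite_set_of_finite_funs) (use face_finite[OF G_face] in auto)
  moreover have "lookup ` box \<subseteq> \<dots>"
  proof safe
    fix w i assume w: "w \<in> box"
    then have le: "lookup w i \<le> (n i - 1 when i \<in> G)"
      by (simp add: box_def lookup_top_exp)
    { assume "i \<in> G"
      moreover from this have "n i \<le> Max (n ` G)"
        using face_finite[OF G_face] by simp
      ultimately show "lookup w i \<le> Max (n ` G)" using le by simp }
    { assume "i \<notin> G" then show "lookup w i = 0" using le by simp }
  qed
  ultimately have "finite (lookup ` box)" by (rule rev_finite_subset)
  then show ?thesis 
    by (rule finite_imageD) (rule inj_onI, simp only: poly_mapping_eq_iff)
qed

lemma lookup_box_poly: "lookup (box_poly g) w = (g (single (reflect w) 1) when w \<in> box)"
  by (simp add: box_poly_def lookup_sum lookup_single when_def sum.delta finite_box)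

lemma lookup_reflect:
  "lookup (reflect w) i = lookup (monomial_exp H) i + lookup top_exp i - lookup w i"
  by (simp add: reflect_def lookup_minus lookup_add)

lemma reflect_in_box:
  assumes "w \<in> box" shows "reflect w \<in> box"
  unfolding box_def
proof (safe)
  fix i
  have "lookup (monomial_exp H) i \<le> lookup w i" "lookup w i \<le> lookup top_exp i"
    using assms by (auto simp: box_def)
  then show "lookup (monomial_exp H) i \<le> lookup (reflect w) i"
    "lookup (reflect w) i \<le> lookup top_exp i"
    by (auto simp: lookup_reflect)
qed

lemma reflect_in_carrier: "w \<in> box \<Longrightarrow> single (reflect w) c \<in> carrier P"
  by (rule single_std_in_carrier[OF box_std[OF reflect_in_box]])

lemma box_poly_in_carrier: "box_poly g \<in> carrier P"
  using std_keys[OF box_std] by (auto simp: carrier_poly_ring lookup_box_poly when_def)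

text \<open>A standard multiple of a monomial in the box is again in the box. So
  \<open>t + reflect w\<close> is at most \<open>top_exp\<close>, which says that
  \<open>t + monomial_exp H\<close> is at most \<open>w\<close>; then \<open>w - t\<close> is in the
  box.\<close>

lemma box_shift:
  assumes w: "w \<in> box" and std: "t + reflect w \<in> std"
  obtains s where "s \<in> box" "w = t + s"
proof
  have "t + reflect w \<in> box"
    using box_keys[OF reflect_in_box[OF w]] by (intro in_boxI[OF std]) (auto simp: keys_add_nat)
  then have refl: "lookup t i + lookup (reflect w) i \<le> lookup top_exp i" for i
    by (simp add: box_def lookup_add)
  have le_top: "lookup w i \<le> lookup top_exp i" for i
    using w by (simp add: box_def)
  have le: "lookup t i + lookup (monomial_exp H) i \<le> lookup w i" for i
    using refl[of i] le_top[of i] unfolding lookup_reflect by linarith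
  show "w = t + (w - t)"
    by (rule poly_mapping_eqI) (use add_leD1[OF le] in \<open>simp add: lookup_add lookup_minus\<close>)
  show "w - t \<in> box" unfolding box_def
  proof (safe)
    fix i
    show "lookup (monomial_exp H) i \<le> lookup (w - t) i" "lookup (w - t) i \<le> lookup top_exp i"
      using le[of i] le_top[of i] by (auto simp: lookup_minus)
  qed
qed

text \<open>With \<open>d = monomial_exp H + top_exp\<close> this is
  \<open>t + (d - (t + s)) = d - s\<close>, where nothing is truncated because \<open>t + s\<close>
  is at most \<open>top_exp\<close>.\<close>

lemma reflect_shift:
  assumes "t + s \<in> box" shows "t + reflect (t + s) = reflect s"
proof (rule poly_mapping_eqI)
  fix i
  have "lookup t i + lookup s i \<le> lookup top_exp i"
    using assms by (simp add: box_def lookup_add)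
  then show "lookup (t + reflect (t + s)) i = lookup (reflect s) i"
    by (simp add: lookup_add lookup_reflect)
qed

text \<open>The key to linearity over \<open>A\<close>. By additivity \<open>p\<close> may be a
  single term at \<open>t\<close>. If \<open>w = t + s\<close> with \<open>s\<close> in the box,
  both sides evaluate \<open>l\<close> at the reflection of \<open>s\<close>, up to the coefficient;
  otherwise both sides vanish.\<close>

lemma box_poly_times:
  fixes l :: "'k::field mpoly set \<Rightarrow> 'k"
  assumes l: "l \<in> carrier \<omega>" and p: "p \<in> carrier P" and w: "w \<in> std"
  shows "lookup (p * box_poly (l \<circ> cls)) w = (l (cls (p * single (reflect w) 1)) when w \<in> box)"
proof -
  let ?Q = "\<lambda>p. p \<in> carrier P \<and>
    lookup (p * box_poly (l \<circ> cls)) w = (l (cls (p * single (reflect w) 1)) when w \<in> box)"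
  have "?Q p"
  proof (rule poly_mapping_induct_keys[where Q = ?Q])
    show "?Q 0" by (simp add: zero_in_carrier omega_zero[OF l])
    show "?Q (p + q)" if "?Q p" "?Q q" for p q
      using that
      by (simp add: add_in_carrier distrib_right lookup_add when_def times_in_carrier
          reflect_in_carrier omega_add[OF l])
    fix t assume "t \<in> keys p"
    let ?c = "lookup p t"
    have kt: "keys t \<subseteq> {1..m}" using p \<open>t \<in> keys p\<close> by (auto simp: carrier_poly_ring in_keys_iff)
    have scale: "l (cls (single s c)) = c * l (cls (single s 1))" if "s \<in> std" for s c
      using omega_scale[OF l single_std_in_carrier[OF that], of c 1] by (simp add: const_def mult_single)
    have "lookup (single t ?c * box_poly (l \<circ> cls)) w
        = (l (cls (single (t + reflect w) ?c)) when w \<in> box)"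
    proof (cases "\<exists>s\<in>box. w = t + s")
      case True
      then obtain s where s: "s \<in> box" "w = t + s" by blast
      have "w \<in> box"
        using box_keys[OF s(1)] s(2) by (intro in_boxI[OF w]) (auto simp: keys_add_nat)
      then show ?thesis
        using s scale[OF box_std[OF reflect_in_box[OF s(1)]], of ?c]
        by (simp add: lookup_single_times_add lookup_box_poly reflect_shift)
    next
      case False
      have "lookup (single t ?c * box_poly (l \<circ> cls)) w = 0"
      proof (rule ccontr)
        assume nz: "lookup (single t ?c * box_poly (l \<circ> cls)) w \<noteq> 0"
        then have "w \<in> keys (single t ?c * box_poly (l \<circ> cls))" by (simp add: in_keys_iff)
        then obtain s where s: "w = t + s" "s \<in> keys (box_poly (l \<circ> cls))"
          using keys_single_times by blast
        with False show False by (auto simp: in_keys_iff lookup_box_poly)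
      qed
      moreover have "l (cls (single (t + reflect w) ?c)) = 0" if "w \<in> box"
      proof -
        \<comment> \<open>By the contrapositive of \<open>box_shift\<close>, the monomial to which
          \<open>l\<close> is applied is zero in \<open>A\<close>.\<close>
        have "t + reflect w \<notin> std" using False box_shift[OF that] by blast
        moreover have "keys (t + reflect w) \<subseteq> {1..m}"
          using kt std_keys[OF box_std[OF reflect_in_box[OF that]]] by (simp add: keys_add_nat)
        ultimately show ?thesis by (simp add: cls_single_eq_zero omega_zero[OF l])
      qed
      ultimately show ?thesis by (simp add: when_def)
    qed
    then show "?Q (single t ?c)"
      using single_in_carrier[OF kt] by (simp add: mult_single)
  qed
  then show ?thesis by blast
qed

definition box_hom :: "('k::field mpoly set \<Rightarrow> 'k) \<Rightarrow> 'k mpoly set" where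
  "box_hom = (\<lambda>l\<in>carrier \<omega>. cls (box_poly (l \<circ> cls)))"

lemma box_hom: "(box_hom :: ('k::field mpoly set \<Rightarrow> 'k) \<Rightarrow> _) \<in> module_Hom A \<omega> (regular_module A)"
  unfolding module_Hom_def
proof (intro CollectI conjI ballI)
  show "(box_hom :: ('k mpoly set \<Rightarrow> 'k) \<Rightarrow> _) \<in> carrier \<omega> \<rightarrow>\<^sub>E carrier (regular_module A)"
    by (auto simp: box_hom_def regular_module_def box_poly_in_carrier)
next
  fix l l' :: "'k mpoly set \<Rightarrow> 'k" assume l: "l \<in> carrier \<omega>" and l': "l' \<in> carrier \<omega>"
  have "cls (box_poly ((l \<oplus>\<^bsub>\<omega>\<^esub> l') \<circ> cls)) = cls (box_poly (l \<circ> cls) + box_poly (l' \<circ> cls))"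
  proof (rule cls_eqI)
    fix t
    show "lookup (box_poly ((l \<oplus>\<^bsub>\<omega>\<^esub> l') \<circ> cls)) t
        = lookup (box_poly (l \<circ> cls) + box_poly (l' \<circ> cls)) t"
      by (simp add: lookup_box_poly lookup_add when_def omega_add_cls reflect_in_carrier)
  qed (simp_all add: box_poly_in_carrier add_in_carrier)
  then show "box_hom (l \<oplus>\<^bsub>\<omega>\<^esub> l') = box_hom l \<oplus>\<^bsub>regular_module A\<^esub> box_hom l'"
    using l l' by (simp add: box_hom_def regular_module_def omega_add_closed cls_add box_poly_in_carrier)
next
  fix X :: "'k mpoly set" and l :: "'k mpoly set \<Rightarrow> 'k" assume X: "X \<in> carrier A" and l: "l \<in> carrier \<omega>"
  then obtain p where p: "p \<in> carrier P" "X = cls p" by (auto simp: carrier_A)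
  have "cls (box_poly ((cls p \<odot>\<^bsub>\<omega>\<^esub> l) \<circ> cls)) = cls (p * box_poly (l \<circ> cls))"
  proof (rule cls_eqI)
    fix t assume t: "t \<in> std"
    show "lookup (box_poly ((cls p \<odot>\<^bsub>\<omega>\<^esub> l) \<circ> cls)) t = lookup (p * box_poly (l \<circ> cls)) t"
      unfolding box_poly_times[OF l p(1) t]
      by (simp add: lookup_box_poly when_def omega_smult_cls reflect_in_carrier p(1))
  qed (simp_all add: box_poly_in_carrier times_in_carrier p)
  then show "box_hom (X \<odot>\<^bsub>\<omega>\<^esub> l) = X \<odot>\<^bsub>regular_module A\<^esub> box_hom l"
    using l p by (simp add: box_hom_def regular_module_def omega_smult_closed cls_mult box_poly_in_carrier)
qed

text \<open>The functional reading off the coefficient at \<open>top_exp\<close> is sent to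
  \<open>x_H\<close>, because the lower corner is the only point of the box reflected to the upper
  one.\<close>

lemma monomial_in_box_hom_image:
  "cls (single (monomial_exp H) 1 :: 'k::field mpoly) \<in> box_hom ` carrier \<omega>"
proof -
  define l :: "'k mpoly set \<Rightarrow> 'k" where "l = restrict (coef top_exp) (carrier A)"
  have top: "top_exp \<in> std" by (rule box_std[OF top_in_box])
  have l_cls: "l (cls p) = lookup p top_exp" if "p \<in> carrier P" for p
    using that top by (simp add: l_def coef_cls)
  have l: "l \<in> carrier \<omega>"
    unfolding omega_carrier_iff
    by (simp add: l_cls add_in_carrier times_in_carrier const_in_carrier lookup_add
        lookup_const_times)
      (simp add: l_def)
  have "cls (box_poly (l \<circ> cls)) = cls (single (monomial_exp H) 1)"
  proof (rule cls_eqI)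
    fix w
    have "reflect w = top_exp \<longleftrightarrow> w = monomial_exp H" if w: "w \<in> box"
    proof
      assume *: "reflect w = top_exp"
      show "w = monomial_exp H"
      proof (rule poly_mapping_eqI)
        fix i
        have "lookup (monomial_exp H) i \<le> lookup w i" "lookup w i \<le> lookup top_exp i"
          using w by (auto simp: box_def)
        with arg_cong[OF *, of "\<lambda>t. lookup t i"] show "lookup w i = lookup (monomial_exp H) i"
          by (simp add: lookup_reflect)
      qed
    qed (simp add: reflect_def)
    then show "lookup (box_poly (l \<circ> cls)) w = lookup (single (monomial_exp H) 1) w"
      using H_in_box
      by (auto simp: lookup_box_poly l_cls reflect_in_carrier lookup_single when_def)
  qed (simp_all add: box_poly_in_carrier single_std_in_carrier[OF box_std[OF H_in_box]])
  then have "box_hom l = cls (single (monomial_exp H) 1)"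
    using l by (simp add: box_hom_def)
  with l show ?thesis by (metis imageI)
qed

end

section \<open>The trace as a monomial ideal and the comparison of exponents\<close>

context artinian_stanley_reisner
begin

interpretation A: cring "A :: 'k::field mpoly set ring"
  by (rule A_cring)

text \<open>If the support \<open>H\<close> of \<open>t\<close> is free, the box homomorphism puts
  \<open>x_H\<close> into the trace, and the monomial at \<open>t\<close> is a multiple of
  \<open>x_H\<close>.\<close>

lemma mspan_free_subset_trace:
  "mspan {t. free_face \<Delta> (keys t)} \<subseteq> trace_ideal (A :: 'k::field mpoly set ring) \<omega>"
proof -
  let ?U = "\<Union>\<phi>\<in>module_Hom A \<omega> (regular_module A). \<phi> ` carrier \<omega> :: 'k mpoly set set"
  have U: "?U \<subseteq> carrier A" by (auto simp: module_Hom_def regular_module_def)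
  interpret T: ideal "trace_ideal A \<omega>" "A :: 'k mpoly set ring"
    unfolding trace_ideal_def by (rule A.genideal_ideal[OF U])
  show ?thesis
  proof (rule mspan_minimal[OF T.ideal_axioms])
    fix t assume t: "t \<in> std" "t \<in> {t. free_face \<Delta> (keys t)}"
    let ?H = "keys t"
    from t(2) have ex1: "\<exists>!G. facet \<Delta> G \<and> ?H \<subseteq> G" by (simp add: free_face_def)
    then obtain G where G: "facet \<Delta> G" "?H \<subseteq> G" by blast
    with ex1 have "G' = G" if "facet \<Delta> G'" "?H \<subseteq> G'" for G' using that by metis
    with G interpret free_face_in_facet m \<Delta> n ?H G by unfold_locales
    have "cls (single (monomial_exp ?H) 1 :: 'k mpoly) \<in> ?U"
      using box_hom monomial_in_box_hom_image by blast
    then have mon: "cls (single (monomial_exp ?H) 1 :: 'k mpoly) \<in> trace_ideal A \<omega>"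
      unfolding trace_ideal_def using A.genideal_self[OF U] by blast
    have t_eq: "t = monomial_exp ?H + (t - monomial_exp ?H)"
      by (rule poly_mapping_eqI)
        (auto simp: lookup_add lookup_minus lookup_monomial_exp when_def in_keys_iff)
    then have "t - monomial_exp ?H \<in> std" using std_addD(2) t(1) by metis
    then have c: "single (t - monomial_exp ?H) (1::'k) \<in> carrier P"
      by (rule single_std_in_carrier)
    have "cls (single (monomial_exp ?H) 1 :: 'k mpoly) \<otimes>\<^bsub>A\<^esub> cls (single (t - monomial_exp ?H) 1)
        \<in> trace_ideal A \<omega>"
      by (rule T.I_r_closed[OF mon cls_in_carrier[OF c]])
    then show "cls (single t 1 :: 'k mpoly) \<in> trace_ideal A \<omega>"
      using t_eq c
      by (simp add: cls_mult single_std_in_carrier[OF box_std[OF H_in_box]] mult_single)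
  qed
qed

lemma trace_eq_mspan_free:
  assumes "flag \<Delta>"
  shows "trace_ideal (A :: 'k::field mpoly set ring) \<omega> = mspan {t. free_face \<Delta> (keys t)}"
  using trace_subset_mspan_free[OF assms] mspan_free_subset_trace by blast

text \<open>Squarefree exponents give the condition on faces. The condition on \<open>n\<close> is
  what forces degree and size of support to agree: an exponent 2 allows degree \<open>q\<close> on a
  support of size \<open>q - 1\<close>.\<close>

lemma free_iff_deg_iff:
  assumes "q \<ge> 1"
  shows "(\<forall>t\<in>std. free_face \<Delta> (keys t) \<longleftrightarrow> deg t \<ge> q) \<longleftrightarrow>
    (\<forall>F\<in>\<Delta>. free_face \<Delta> F \<longleftrightarrow> card F \<ge> q) \<and> (q \<ge> 2 \<longrightarrow> (\<forall>i\<in>{1..m}. n i = 2))"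
    (is "?L \<longleftrightarrow> ?R1 \<and> ?R2")
proof
  assume L: ?L
  have R1: ?R1
  proof
    fix F assume F: "F \<in> \<Delta>"
    from L[rule_format, OF monomial_exp_std[OF F]]
    show "free_face \<Delta> F \<longleftrightarrow> card F \<ge> q"
      by (simp add: keys_monomial_exp face_finite[OF F] deg_monomial_exp[OF F])
  qed
  moreover have ?R2
  proof (intro impI ballI, rule ccontr)
    fix i assume q: "q \<ge> 2" and i: "i \<in> {1..m}" and "n i \<noteq> 2"
    then have n: "n i \<ge> 3" using n_ge_2 by fastforce
    have "{i} \<in> \<Delta>" using no_ghost i by (simp add: ghost_vertex_def)
    then obtain F where F: "facet \<Delta> F" "{i} \<subseteq> F" by (rule face_in_facet)
    then have "F \<in> \<Delta>" and "free_face \<Delta> F"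
      unfolding free_face_def facet_def by auto
    then have "card F \<ge> q" using R1 by blast
    \<comment> \<open>A facet is free, so it has at least \<open>q\<close> vertices, leaving enough
      besides \<open>i\<close> to choose \<open>q - 2\<close>.\<close>
    then have "q - 2 \<le> card (F - {i})"
      using F(2) face_finite[OF \<open>F \<in> \<Delta>\<close>] by simp
    then obtain K where K: "K \<subseteq> F - {i}" "card K = q - 2" "finite K"
      by (rule obtain_subset_with_card_n)
    \<comment> \<open>The exponent is 2 at \<open>i\<close>, allowed by \<open>n i \<ge> 3\<close>,
      and 1 on \<open>K\<close>: its degree is \<open>q\<close>, but its support has only
      \<open>q - 1\<close> vertices.\<close>
    let ?F = "insert i K" and ?t = "monomial_exp (insert i K) + single i 1"
    have face: "?F \<in> \<Delta>" using K F(2) face_subset[OF \<open>F \<in> \<Delta>\<close>] by blast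
    have card: "card ?F = q - 1" using K q by (subst card_insert_disjoint) auto
    have keys: "keys ?t = ?F" by (auto simp: keys_add_nat keys_monomial_exp K(3))
    have "lookup ?t j < n j" if "j \<in> ?F" for j
      using that n n_ge_2 face_verts[OF face]
      by (force simp: lookup_add lookup_monomial_exp K(3) lookup_single when_def)
    then have "?t \<in> std" using keys face unfolding std_def by simp
    moreover have "deg ?t = q"
      using card q deg_single[OF i] by (simp add: deg_add deg_monomial_exp[OF face])
    ultimately have "free_face \<Delta> ?F" using L keys by force
    with R1 face card q show False by force
  qed
  ultimately show "?R1 \<and> ?R2" by blast
next
  assume R: "?R1 \<and> ?R2"
  show ?L
  proof
    fix t assume t: "t \<in> std"
    then have face: "keys t \<in> \<Delta>" by (simp add: std_def)
    have deg: "deg t = (\<Sum>i\<in>keys t. lookup t i)"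
      unfolding deg_def by (rule sum.mono_neutral_right) (use std_keys[OF t] in \<open>auto simp: in_keys_iff\<close>)
    have "card (keys t) \<ge> q \<longleftrightarrow> deg t \<ge> q"
    proof (cases "q = 1")
      case True
      \<comment> \<open>For \<open>q = 1\<close> both inequalities say that the support is nonempty,
        whatever the bounds \<open>n i\<close> are.\<close>
      have "deg t \<noteq> 0 \<longleftrightarrow> keys t \<noteq> {}" unfolding deg
        by (simp del: keys_eq_empty) (metis all_not_in_conv in_keys_iff neq0_conv)
      moreover have "card (keys t) \<noteq> 0 \<longleftrightarrow> keys t \<noteq> {}" by simp
      ultimately show ?thesis using True by linarith
    next
      case False
      then have two: "\<forall>i\<in>{1..m}. n i = 2" using R assms by auto
      \<comment> \<open>With all bounds equal to 2, standard monomials are squarefree, and degree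
        equals size of support.\<close>
      have "lookup t i = 1" if "i \<in> keys t" for i
      proof -
        have "lookup t i < 2" using two std_keys[OF t] std_lessD[OF t that] that by force
        then show ?thesis using that by (simp add: in_keys_iff)
      qed
      then have "deg t = card (keys t)" unfolding deg by simp
      then show ?thesis by simp
    qed
    with R face show "free_face \<Delta> (keys t) \<longleftrightarrow> deg t \<ge> q" by blast
  qed
qed

end

theorem corollary7p3:
  fixes m q :: nat and \<Delta> :: "nat set set" and n :: "nat \<Rightarrow> nat"
    and A :: "('k::field) mpoly set ring" and \<kappa> :: "'k \<Rightarrow> 'k mpoly set"
    and mA :: "'k mpoly set set"
  assumes "simplicial_complex_on m \<Delta>"
    and "\<forall>i\<in>{1..m}. \<not> ghost_vertex \<Delta> i"
    and "\<forall>i\<in>{1..m}. n i \<ge> 2"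
    and A: "A = artinian_algebra m \<Delta> n"
    and \<kappa>: "\<kappa> = (\<lambda>c. residue_class m \<Delta> n (const c))"
    and mA: "mA = graded_maximal_ideal m \<Delta> n"
    and "q \<ge> 1"
    and "flag \<Delta>"
  shows "trace_ideal A (canonical_module \<kappa> A) = mA [^]\<^bsub>ideals_set A\<^esub> q \<longleftrightarrow>
    (\<forall>F\<in>\<Delta>. free_face \<Delta> F \<longleftrightarrow> card F \<ge> q) \<and>
    (q \<ge> 2 \<longrightarrow> (\<forall>i\<in>{1..m}. n i = 2))"
proof -
  interpret R: artinian_stanley_reisner m \<Delta> n
    by unfold_locales (use assms in auto)
  have "trace_ideal A (canonical_module \<kappa> A) = mA [^]\<^bsub>ideals_set A\<^esub> q \<longleftrightarrow>
      (R.mspan {t. free_face \<Delta> (keys t)} :: 'k mpoly set set) = R.mspan {t. R.deg t \<ge> q}"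
    unfolding A \<kappa> mA R.trace_eq_mspan_free[OF \<open>flag \<Delta>\<close>] R.graded_maximal_ideal_power ..
  also have "\<dots> \<longleftrightarrow> (\<forall>t\<in>R.std. free_face \<Delta> (keys t) \<longleftrightarrow> R.deg t \<ge> q)"
    unfolding set_eq_subset R.mspan_subset_iff by blast
  finally show ?thesis unfolding R.free_iff_deg_iff[OF \<open>q \<ge> 1\<close>] .
qed

end
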